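(* Let $\Delta(z)=q_z\prod_{n\ge1}(1-q_z^n)^{24}$ be Ramanujan's delta function and $E_4(z)=1+240\sum_{n\ge1}\Big(\sum_{r\mid n}r^3\Big)q_z^n$ the Eisenstein series of weight 4, where $q_z=e^{2\pi i z}$. Write the Fourier expansion at $i\infty$ as $$64\,\frac{\Delta(z)}{E_4(z)^2}=\sum_{n\ge1}a(n)q_z^n .$$ Then $n\mid a(n)$ for all integers $n\ge1$.
   Context: The coefficients $a(n)$ are integers, since $\Delta$ and $E_4$ have integral Fourier coefficients and $E_4$ has constant term 1. *)

theory Defs
  imports "HOL-Analysis.Analysis"
begin

definition nome :: "complex \<Rightarrow> complex" where
  "nome z = exp (2 * of_real pi * \<i> * z)"

text \<open>The products and sums over \<open>n \<ge> 1\<close> are indexed from 0 through \<open>Suc n\<close>.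
  The functions are meaningful on the upper half-plane, where \<open>nome z\<close> has norm
  less than 1; elsewhere their values are unspecified and never used.\<close>

definition Ramanujan_Delta :: "complex \<Rightarrow> complex" where
  "Ramanujan_Delta z = nome z * prodinf (\<lambda>n. (1 - nome z ^ Suc n) ^ 24)"

definition Eisenstein_E4 :: "complex \<Rightarrow> complex" where
  "Eisenstein_E4 z =
     1 + 240 * suminf (\<lambda>n. (\<Sum>r | r dvd Suc n. of_nat r ^ 3) * nome z ^ Suc n)"

text \<open>A Fourier expansion at \<open>i\<infinity>\<close> without constant term. The identity is only
  demanded for large imaginary part because a function such as
  \<open>Ramanujan_Delta z / (Eisenstein_E4 z)\<^sup>2\<close> has poles in the upper half-plane.
  The value \<open>a 0\<close> plays no role.\<close>

definition has_cuspidal_Fourier_expansion ::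
    "(complex \<Rightarrow> complex) \<Rightarrow> (nat \<Rightarrow> complex) \<Rightarrow> bool" where
  "has_cuspidal_Fourier_expansion f a \<longleftrightarrow>
     (\<exists>Y > 0. \<forall>z. Im z > Y \<longrightarrow> (\<lambda>n. a (Suc n) * nome z ^ Suc n) sums f z)"

end

theory Submission
  imports Defs "HOL-Complex_Analysis.Complex_Analysis"
begin

text \<open>Put \<open>t = \<Delta> / E\<^sub>4\<^sup>3 = 1 / j\<close> and \<open>D = q d/dq\<close>. Ramanujan's differential equations give
  \<open>D t = t E\<^sub>6 / E\<^sub>4\<close>, \<open>E\<^sub>6\<^sup>2 = E\<^sub>4\<^sup>3 (1 - 1728 t)\<close>, and the classical
  \<open>\<surd>E\<^sub>4 = \<Sum>\<^sub>k u\<^sub>k t\<^sup>k\<close> with \<open>u\<^sub>k = (6k)! / ((3k)! k!\<^sup>3)\<close>. The parameter \<open>x\<close> defined by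
  \<open>t = x / (1 + 432 x)\<^sup>2\<close> has an integral \<open>q\<close>-expansion and rationalises
  \<open>\<surd>(1 - 1728 t) = (1 - 432 x) / (1 + 432 x)\<close>, so that
  \<open>\<Delta> / E\<^sub>4\<^sup>2 = D g\<close> with \<open>dg/dx = \<Sum>\<^sub>k u\<^sub>k x\<^sup>k / (1 + 432 x) ^ (2 k + 2)\<close>. The coefficient of
  \<open>x\<^sup>N\<close> in \<open>g\<close> is \<open>1 / N\<close> times a sum of the numbers
  \<open>(- 432) ^ (N - 1 - k) u\<^sub>k (N + k choose (2 k + 1))\<close>, each of which is divisible by \<open>N\<close>. Hence \<open>g\<close> has
  integral coefficients, and the \<open>n\<close>-th coefficient of \<open>\<Delta> / E\<^sub>4\<^sup>2\<close> is \<open>n\<close> times that of \<open>g\<close>.\<close>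

subsection \<open>A Liouville-type summation identity\<close>

definition quads :: "nat \<Rightarrow> (nat \<times> nat \<times> nat \<times> nat) set" where
  "quads n = {(a, b, x, y). 0 < a \<and> 0 < b \<and> 0 < x \<and> 0 < y \<and> a * x + b * y = n}"

lemma finite_quads: "finite (quads n)"
proof (rule finite_subset)
  show "quads n \<subseteq> {..n} \<times> {..n} \<times> {..n} \<times> {..n}"
  proof (rule subsetI)
    fix q assume "q \<in> quads n"
    then obtain a b x y where q: "q = (a, b, x, y)" and "0 < a" "0 < b" "0 < x" "0 < y"
      and n: "n = a * x + b * y"
      by (auto simp: quads_def)
    then have "a \<le> a * x" "x \<le> a * x" "b \<le> b * y" "y \<le> b * y"
      by auto
    then show "q \<in> {..n} \<times> {..n} \<times> {..n} \<times> {..n}"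
      unfolding n q by (auto intro: trans_le_add1 trans_le_add2)
  qed
qed auto

lemma sum_split_trichotomy:
  fixes u v :: "'b \<Rightarrow> nat"
  assumes "finite S"
  shows "sum f S = sum f {q \<in> S. u q > v q} + sum f {q \<in> S. u q < v q} + sum f {q \<in> S. u q = v q}"
proof -
  have "S = {q \<in> S. u q > v q} \<union> {q \<in> S. u q < v q} \<union> {q \<in> S. u q = v q}"
    by auto
  then have "sum f S = sum f ({q \<in> S. u q > v q} \<union> {q \<in> S. u q < v q} \<union> {q \<in> S. u q = v q})"
    by (rule arg_cong)
  also have "\<dots> = sum f ({q \<in> S. u q > v q} \<union> {q \<in> S. u q < v q}) + sum f {q \<in> S. u q = v q}"
    by (rule sum.union_disjoint) (use assms in auto)
  also have "sum f ({q \<in> S. u q > v q} \<union> {q \<in> S. u q < v q})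
      = sum f {q \<in> S. u q > v q} + sum f {q \<in> S. u q < v q}"
    by (rule sum.union_disjoint) (use assms in auto)
  finally show ?thesis .
qed

text \<open>The shears \<open>(a, b, x, y) \<mapsto> (a - b, b, x, x + y)\<close> for \<open>a > b\<close> and
  \<open>(a, b, x, y) \<mapsto> (a, b - a, x + y, y)\<close> for \<open>a < b\<close> preserve \<open>a * x + b * y\<close>, so only the
  quadruples with \<open>a = b\<close> or \<open>x = y\<close> survive in the difference.\<close>

lemma sum_quads_reduction:
  fixes h H :: "nat \<Rightarrow> nat \<Rightarrow> 'a :: comm_ring_1"
  assumes n: "n > 0"
    and h1: "\<And>u v. u > 0 \<Longrightarrow> v > 0 \<Longrightarrow> h (u + v) v = H u v"
    and h2: "\<And>u v. u > 0 \<Longrightarrow> v > 0 \<Longrightarrow> h u (u + v) = H u v"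
  shows "(\<Sum>(a, b, x, y)\<in>quads n. h a b - H a b) =
           (\<Sum>d | d dvd n. of_nat (n div d - 1) * h d d - (\<Sum>b=1..<d. h d b))"
proof -
  let ?h = "\<lambda>(a, b, x, y). h a b" and ?H = "\<lambda>(a, b, x, y). H a b"
  let ?a = "\<lambda>(a, b, x, y). a" and ?b = "\<lambda>(a, b, x, y). b"
  let ?x = "\<lambda>(a, b, x, y). x" and ?y = "\<lambda>(a, b, x, y). y"
  have h1': "H (a - b) b = h a b" if "0 < b" "b < a" for a b
    using h1[of "a - b" b] that by simp
  have h2': "H a (b - a) = h a b" if "0 < a" "a < b" for a b
    using h2[of a "b - a"] that by simp
  have shear: "(a - b) * x + b * (x + y) = a * x + b * y" if "b < a" for a b x y :: nat
    using mult_le_mono1[OF less_imp_le[OF that], of x]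
    by (simp add: diff_mult_distrib add_mult_distrib2)
  have shear': "(a + b) * x + b * (y - x) = a * x + b * y" if "x < y" for a b x y :: nat
    using mult_le_mono2[OF less_imp_le[OF that], of b]
    by (simp add: diff_mult_distrib2 add_mult_distrib)
  have shearl: "a * (x + y) + (b - a) * y = a * x + b * y" if "a < b" for a b x y :: nat
    using shear[OF that, of y x] by (simp add: ac_simps)
  have shearl': "a * (x - y) + (a + b) * y = a * x + b * y" if "y < x" for a b x y :: nat
    using shear'[OF that, of b a] by (simp add: ac_simps)
  have split_antidiag: "d * x + d * (n div d - x) = n" if "d dvd n" "x < n div d" for d x
    using that by (simp flip: add_mult_distrib2)
  have merge_diag: "a dvd n" "n div a = x + y" if "a * x + a * y = n" "0 < a" for a x y
    using that by (auto simp flip: add_mult_distrib2)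
  have split_diag: "(d - b) * (n div d) + b * (n div d) = n" if "d dvd n" "b < d" for d b
    using that by (simp flip: add_mult_distrib)
  have merge_antidiag: "a + b dvd a * x + b * x" "0 < a \<Longrightarrow> (a * x + b * x) div (a + b) = x" for a b x :: nat
    by (auto simp flip: add_mult_distrib)
  have gt: "sum ?h {q \<in> quads n. ?a q > ?b q} = sum ?H {q \<in> quads n. ?x q < ?y q}"
    by (rule sum.reindex_bij_witness
          [where i = "\<lambda>(a, b, x, y). (a + b, b, x, y - x)" and j = "\<lambda>(a, b, x, y). (a - b, b, x, x + y)"])
       (auto simp: quads_def h1' shear shear')
  have lt: "sum ?h {q \<in> quads n. ?a q < ?b q} = sum ?H {q \<in> quads n. ?x q > ?y q}"
    by (rule sum.reindex_bij_witness
          [where i = "\<lambda>(a, b, x, y). (a, a + b, x - y, y)" and j = "\<lambda>(a, b, x, y). (a, b - a, x + y, y)"])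
       (auto simp: quads_def h2' shearl shearl')
  \<comment> \<open>With \<open>a = b = d\<close> the equation becomes
    \<open>d * (x + y) = n\<close>, which leaves \<open>n div d - 1\<close> choices for
    \<open>x\<close>.\<close>
  have "sum ?h {q \<in> quads n. ?a q = ?b q}
      = (\<Sum>(d, x)\<in>(SIGMA d:{d. d dvd n}. {1..<n div d}). h d d)"
    by (rule sum.reindex_bij_witness
          [where i = "\<lambda>(d, x). (d, d, x, n div d - x)" and j = "\<lambda>(a, b, x, y). (a, x)"])
       (use n in \<open>auto simp: quads_def split_antidiag merge_diag\<close>)
  also have "\<dots> = (\<Sum>d | d dvd n. \<Sum>x\<in>{1..<n div d}. h d d)"
    by (rule sum.Sigma[symmetric]) (use n in auto)
  also have "\<dots> = (\<Sum>d | d dvd n. of_nat (n div d - 1) * h d d)"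
    by simp
  finally have eqh: "sum ?h {q \<in> quads n. ?a q = ?b q} = (\<Sum>d | d dvd n. of_nat (n div d - 1) * h d d)" .
  \<comment> \<open>With \<open>x = y\<close> the sum \<open>d = a + b\<close> divides
    \<open>n\<close>, and \<open>h1\<close> turns \<open>H (d - b) b\<close> into
    \<open>h d b\<close> for \<open>b\<close> from 1 to \<open>d - 1\<close>.\<close>
  have "sum ?H {q \<in> quads n. ?x q = ?y q} = (\<Sum>(d, b)\<in>(SIGMA d:{d. d dvd n}. {1..<d}). h d b)"
    by (rule sum.reindex_bij_witness
          [where i = "\<lambda>(d, b). (d - b, b, n div d, n div d)" and j = "\<lambda>(a, b, x, y). (a + b, b)"])
       (use n in \<open>auto simp: quads_def h1 split_diag merge_antidiag div_greater_zero_iff dvd_imp_le\<close>)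
  also have "\<dots> = (\<Sum>d | d dvd n. \<Sum>b=1..<d. h d b)"
    by (rule sum.Sigma[symmetric]) (use n in auto)
  finally have eqH: "sum ?H {q \<in> quads n. ?x q = ?y q} = (\<Sum>d | d dvd n. \<Sum>b=1..<d. h d b)" .
  have "sum ?h (quads n) - sum ?H (quads n) =
      (\<Sum>d | d dvd n. of_nat (n div d - 1) * h d d) - (\<Sum>d | d dvd n. \<Sum>b=1..<d. h d b)"
    unfolding sum_split_trichotomy[OF finite_quads, of ?h n ?b ?a]
      sum_split_trichotomy[OF finite_quads, of ?H n ?y ?x] gt lt eqh eqH
    by (simp only: add.commute[of "sum ?H {q \<in> quads n. ?x q < ?y q}"] add_diff_cancel_left)
  then show ?thesis
    by (simp add: sum_subtractf case_prod_unfold)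
qed


subsection \<open>Ramanujan's differential equations\<close>

text \<open>The constant coefficient is a sum over the infinite set of divisors of 0, hence 0.\<close>

definition divisor_fps :: "(nat \<Rightarrow> 'a :: comm_ring_1) \<Rightarrow> 'a fps" where
  "divisor_fps f = Abs_fps (\<lambda>n. \<Sum>d | d dvd n. f d)"

lemma divisor_fps_nth: "fps_nth (divisor_fps f) n = (\<Sum>d | d dvd n. f d)"
  by (simp add: divisor_fps_def)

lemma divisor_fps_nth_0 [simp]: "fps_nth (divisor_fps f) 0 = 0"
  by (simp add: divisor_fps_nth infinite_UNIV_nat)

text \<open>In a term of the Cauchy product, divisors \<open>a\<close> of \<open>m\<close> and
  \<open>b\<close> of \<open>n - m\<close> determine the cofactors \<open>x\<close> and
  \<open>y\<close>. The ends \<open>m = 0\<close> and \<open>m = n\<close> drop out because constant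
  coefficients are 0, which matches the positivity demanded in \<open>quads\<close>.\<close>

lemma divisor_fps_mult_nth:
  "fps_nth (divisor_fps f * divisor_fps g) n = (\<Sum>(a, b, x, y)\<in>quads n. f a * g b)"
proof -
  let ?D = "\<lambda>m. {a. a dvd m} \<times> {b. b dvd n - m}"
  have pos: "0 < a" "0 < m div a" if "a dvd m" "0 < m" for a m :: nat
    using that by (auto simp: div_greater_zero_iff dvd_imp_le intro: dvd_pos_nat)
  have "fps_nth (divisor_fps f * divisor_fps g) n
      = (\<Sum>m=0..n. fps_nth (divisor_fps f) m * fps_nth (divisor_fps g) (n - m))"
    by (rule fps_mult_nth)
  also have "\<dots> = (\<Sum>m\<in>{1..<n}. fps_nth (divisor_fps f) m * fps_nth (divisor_fps g) (n - m))"
    by (rule sum.mono_neutral_right) (auto simp: le_less not_less)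
  also have "\<dots> = (\<Sum>m\<in>{1..<n}. \<Sum>(a, b)\<in>?D m. f a * g b)"
    by (simp add: divisor_fps_nth sum_product sum.cartesian_product)
  also have "\<dots> = (\<Sum>(m, a, b)\<in>(SIGMA m:{1..<n}. ?D m). f a * g b)"
    by (subst sum.Sigma) (auto simp: case_prod_unfold)
  also have "\<dots> = (\<Sum>(a, b, x, y)\<in>quads n. f a * g b)"
    by (rule sum.reindex_bij_witness
          [where i = "\<lambda>(a, b, x, y). (a * x, a, b)" and j = "\<lambda>(m, a, b). (a, b, m div a, (n - m) div b)"])
       (auto simp: quads_def pos Suc_le_eq)
  finally show ?thesis .
qed

section \<open>Products of divisor power sums\<close>

abbreviation sigma_fps :: "nat \<Rightarrow> 'a :: comm_ring_1 fps" where
  "sigma_fps k \<equiv> divisor_fps (\<lambda>d. of_nat d ^ k)"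

text \<open>Faulhaber's formulas with cleared denominators, so that each induction step is a
  polynomial identity over any commutative ring.\<close>

lemma sum_powers:
  fixes d :: nat
  defines "D \<equiv> of_nat d :: 'a :: comm_ring_1"
  shows "2 * (\<Sum>b<d. of_nat b) = D ^ 2 - D"
    and "6 * (\<Sum>b<d. of_nat b ^ 2) = 2 * D ^ 3 - 3 * D ^ 2 + D"
    and "4 * (\<Sum>b<d. of_nat b ^ 3) = D ^ 4 - 2 * D ^ 3 + D ^ 2"
    and "30 * (\<Sum>b<d. of_nat b ^ 4) = 6 * D ^ 5 - 15 * D ^ 4 + 10 * D ^ 3 - D"
    and "12 * (\<Sum>b<d. of_nat b ^ 5) = 2 * D ^ 6 - 6 * D ^ 5 + 5 * D ^ 4 - D ^ 2"
    and "42 * (\<Sum>b<d. of_nat b ^ 6) = 6 * D ^ 7 - 21 * D ^ 6 + 21 * D ^ 5 - 7 * D ^ 3 + D"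
  unfolding D_def
  by (induction d) (simp_all add: distrib_left, simp_all add: algebra_simps eval_nat_numeral)

text \<open>Serves to sum the degree 6 polynomial \<open>h d b\<close> over \<open>b\<close>.
  Starting at \<open>b = 1\<close> affects only the constant term, hence the factor
  \<open>D - 1\<close>.\<close>

lemma sum_sextic:
  fixes c0 :: "'a :: field_char_0"
  assumes "d > 0"
  defines "D \<equiv> of_nat d :: 'a"
  shows "(\<Sum>b=1..<d. c0 + c1 * of_nat b + c2 * of_nat b ^ 2 + c3 * of_nat b ^ 3
             + c4 * of_nat b ^ 4 + c5 * of_nat b ^ 5 + c6 * of_nat b ^ 6) =
    c0 * (D - 1) + c1 * ((D ^ 2 - D) / 2) + c2 * ((2 * D ^ 3 - 3 * D ^ 2 + D) / 6)
      + c3 * ((D ^ 4 - 2 * D ^ 3 + D ^ 2) / 4) + c4 * ((6 * D ^ 5 - 15 * D ^ 4 + 10 * D ^ 3 - D) / 30)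
      + c5 * ((2 * D ^ 6 - 6 * D ^ 5 + 5 * D ^ 4 - D ^ 2) / 12)
      + c6 * ((6 * D ^ 7 - 21 * D ^ 6 + 21 * D ^ 5 - 7 * D ^ 3 + D) / 42)"
    (is "sum ?f _ = _")
proof -
  have *: "y = x / c" if "c * y = x" "c \<noteq> 0" for c x y :: 'a
    using that by (simp add: field_simps)
  have "{..<d} = insert 0 {1..<d}"
    using assms by auto
  then have "sum ?f {1..<d} = sum ?f {..<d} - c0"
    by simp
  also have "\<dots> = c0 * (D - 1) + c1 * (\<Sum>b<d. of_nat b) + c2 * (\<Sum>b<d. of_nat b ^ 2)
      + c3 * (\<Sum>b<d. of_nat b ^ 3) + c4 * (\<Sum>b<d. of_nat b ^ 4)
      + c5 * (\<Sum>b<d. of_nat b ^ 5) + c6 * (\<Sum>b<d. of_nat b ^ 6)"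
    by (simp add: sum.distrib sum_distrib_left D_def algebra_simps)
  also note *[OF sum_powers(1)]
  also note *[OF sum_powers(2)]
  also note *[OF sum_powers(3)]
  also note *[OF sum_powers(4)]
  also note *[OF sum_powers(5)]
  also note *[OF sum_powers(6)]
  finally show ?thesis
    by (simp add: D_def)
qed

text \<open>The polynomials in \<open>a\<^sup>2 - a b + b\<^sup>2\<close> and \<open>(a b (a - b))\<^sup>2\<close> are those to which the
  reduction applies.\<close>

lemma sum_quads_binary_form:
  fixes c1 c2 c3 c4 :: "'a :: field_char_0" and n :: nat
  defines "h \<equiv> \<lambda>a b. c1 * (a\<^sup>2 - a * b + b\<^sup>2) + c2 * (a\<^sup>2 - a * b + b\<^sup>2) ^ 2
    + c3 * (a\<^sup>2 - a * b + b\<^sup>2) ^ 3 + c4 * (a * b * (a - b)) ^ 2"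
  assumes "n > 0"
  shows "(\<Sum>(a, b, x, y)\<in>quads n. h (of_nat a) (of_nat b) - h (of_nat a + of_nat b) (of_nat b)) =
    of_nat n * (\<Sum>d | d dvd n. c1 * of_nat d + c2 * of_nat d ^ 3 + c3 * of_nat d ^ 5)
    - (\<Sum>d | d dvd n. (let D = of_nat d in c1 * (5 * D ^ 3 + D) / 6
          + c2 * (21 * D ^ 5 + 10 * D ^ 3 - D) / 30
          + c4 * (D ^ 7 - D ^ 3) / 30
          + c3 * (249 * D ^ 7 + 210 * D ^ 5 - 49 * D ^ 3 + 10 * D) / 420))"
proof -
  have hh: "h A b = (c1 * A ^ 2 + c2 * A ^ 4 + c3 * A ^ 6)
      + (- c1 * A - 2 * c2 * A ^ 3 - 3 * c3 * A ^ 5) * b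
      + (c1 + 3 * c2 * A ^ 2 + 6 * c3 * A ^ 4 + c4 * A ^ 4) * b ^ 2
      + (- 2 * c2 * A - 7 * c3 * A ^ 3 - 2 * c4 * A ^ 3) * b ^ 3
      + (c2 + 6 * c3 * A ^ 2 + c4 * A ^ 2) * b ^ 4
      + (- 3 * c3 * A) * b ^ 5 + c3 * b ^ 6" for A b
    unfolding h_def by algebra
  \<comment> \<open>Both building blocks of \<open>h\<close> are invariant under exchanging the
    arguments and under replacing \<open>b\<close> by \<open>a - b\<close>; together these carry
    \<open>(u, u + v)\<close> to \<open>(u + v, v)\<close>.\<close>
  have shift: "h u (u + v) = h (u + v) v" for u v
    unfolding h_def by algebra
  have eq: "of_nat (n div d - 1) * h (of_nat d) (of_nat d) - (\<Sum>b=1..<d. h (of_nat d) (of_nat b))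
      = of_nat n * (c1 * of_nat d + c2 * of_nat d ^ 3 + c3 * of_nat d ^ 5)
        - (let D = of_nat d in c1 * (5 * D ^ 3 + D) / 6
          + c2 * (21 * D ^ 5 + 10 * D ^ 3 - D) / 30
          + c4 * (D ^ 7 - D ^ 3) / 30
          + c3 * (249 * D ^ 7 + 210 * D ^ 5 - 49 * D ^ 3 + 10 * D) / 420)" if "d dvd n" for d
  proof -
    from that obtain m where m: "n = d * m" ..
    with assms have d: "d > 0" and "m > 0"
      by auto
    then have 1: "of_nat (n div d - 1) = of_nat m - (1 :: 'a)"
      by (simp add: m of_nat_diff)
    show ?thesis
      unfolding 1 hh sum_sextic[OF d] Let_def
      unfolding m of_nat_mult
      by (simp add: field_simps eval_nat_numeral)
  qed
  have "(\<Sum>(a, b, x, y)\<in>quads n. h (of_nat a) (of_nat b) - h (of_nat a + of_nat b) (of_nat b))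
      = (\<Sum>d | d dvd n. of_nat (n div d - 1) * h (of_nat d) (of_nat d)
          - (\<Sum>b=1..<d. h (of_nat d) (of_nat b)))"
    by (rule sum_quads_reduction[OF assms(2)]) (simp_all add: shift)
  also have "\<dots> = (\<Sum>d | d dvd n. of_nat n * (c1 * of_nat d + c2 * of_nat d ^ 3 + c3 * of_nat d ^ 5)
        - (let D = of_nat d in c1 * (5 * D ^ 3 + D) / 6
          + c2 * (21 * D ^ 5 + 10 * D ^ 3 - D) / 30
          + c4 * (D ^ 7 - D ^ 3) / 30
          + c3 * (249 * D ^ 7 + 210 * D ^ 5 - 49 * D ^ 3 + 10 * D) / 420))"
    by (rule sum.cong[OF refl]) (use eq in auto)
  finally show ?thesis
    by (simp only: sum_subtractf sum_distrib_left)
qed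

text \<open>\<open>P\<close>, \<open>Q\<close>, \<open>R\<close> are Ramanujan's names for \<open>E\<^sub>2\<close>, \<open>E\<^sub>4\<close>, \<open>E\<^sub>6\<close>.\<close>

definition P_fps :: "'a :: field_char_0 fps" where "P_fps = 1 - 24 * sigma_fps 1"
definition Q_fps :: "'a :: field_char_0 fps" where "Q_fps = 1 + 240 * sigma_fps 3"
definition R_fps :: "'a :: field_char_0 fps" where "R_fps = 1 - 504 * sigma_fps 5"

lemma sigma_fps_mult_nth:
  "fps_nth (sigma_fps i * sigma_fps j) n = (\<Sum>(a, b, x, y)\<in>quads n. of_nat a ^ i * of_nat b ^ j)"
  by (rule divisor_fps_mult_nth)

text \<open>For the polynomial \<open>h\<close> of \<open>sum_quads_binary_form\<close>,
  \<open>h (a + b) b = h a (- b)\<close>, so the summand is twice the part of \<open>h\<close> odd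
  in \<open>b\<close>. All terms of \<open>h\<close> have even degree, hence only products of two
  odd powers survive. The parameters stay free so that each differential equation can pick its own
  combination.\<close>

lemma sigma_fps_relations:
  fixes \<alpha> \<beta> \<gamma> \<delta> :: "'a :: field_char_0"
  assumes "n > 0"
  defines "\<sigma> \<equiv> \<lambda>k. fps_nth (sigma_fps k) n :: 'a"
    and "\<tau> \<equiv> \<lambda>i j. fps_nth (sigma_fps i * sigma_fps j) n :: 'a"
  shows "\<alpha> * (- 2 * \<tau> 1 1) + \<beta> * (- 4 * \<tau> 1 3 - 4 * \<tau> 3 1)
      + \<gamma> * (- 6 * \<tau> 1 5 - 14 * \<tau> 3 3 - 6 * \<tau> 5 1) - 4 * \<delta> * \<tau> 3 3 =
    of_nat n * (\<alpha> * \<sigma> 1 + \<beta> * \<sigma> 3 + \<gamma> * \<sigma> 5)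
    - \<alpha> * (5 * \<sigma> 3 + \<sigma> 1) / 6 - \<beta> * (21 * \<sigma> 5 + 10 * \<sigma> 3 - \<sigma> 1) / 30
    - \<gamma> * (249 * \<sigma> 7 + 210 * \<sigma> 5 - 49 * \<sigma> 3 + 10 * \<sigma> 1) / 420 - \<delta> * (\<sigma> 7 - \<sigma> 3) / 30"
proof -
  have *: "\<alpha> * (- 2 * (a ^ 1 * b ^ 1)) + \<beta> * (- 4 * (a ^ 1 * b ^ 3) - 4 * (a ^ 3 * b ^ 1))
      + \<gamma> * (- 6 * (a ^ 1 * b ^ 5) - 14 * (a ^ 3 * b ^ 3) - 6 * (a ^ 5 * b ^ 1)) - 4 * \<delta> * (a ^ 3 * b ^ 3)
    = \<alpha> * (a\<^sup>2 - a * b + b\<^sup>2) + \<beta> * (a\<^sup>2 - a * b + b\<^sup>2) ^ 2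
      + \<gamma> * (a\<^sup>2 - a * b + b\<^sup>2) ^ 3 + \<delta> * (a * b * (a - b)) ^ 2
      - (\<alpha> * ((a + b)\<^sup>2 - (a + b) * b + b\<^sup>2) + \<beta> * ((a + b)\<^sup>2 - (a + b) * b + b\<^sup>2) ^ 2
      + \<gamma> * ((a + b)\<^sup>2 - (a + b) * b + b\<^sup>2) ^ 3 + \<delta> * ((a + b) * b * ((a + b) - b)) ^ 2)"
    for a b :: 'a
    by algebra
  have "\<alpha> * (- 2 * \<tau> 1 1) + \<beta> * (- 4 * \<tau> 1 3 - 4 * \<tau> 3 1)
      + \<gamma> * (- 6 * \<tau> 1 5 - 14 * \<tau> 3 3 - 6 * \<tau> 5 1) - 4 * \<delta> * \<tau> 3 3 =
    (\<Sum>(a, b, x, y)\<in>quads n. \<alpha> * (- 2 * (of_nat a ^ 1 * of_nat b ^ 1))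
      + \<beta> * (- 4 * (of_nat a ^ 1 * of_nat b ^ 3) - 4 * (of_nat a ^ 3 * of_nat b ^ 1))
      + \<gamma> * (- 6 * (of_nat a ^ 1 * of_nat b ^ 5) - 14 * (of_nat a ^ 3 * of_nat b ^ 3)
          - 6 * (of_nat a ^ 5 * of_nat b ^ 1)) - 4 * \<delta> * (of_nat a ^ 3 * of_nat b ^ 3))"
    unfolding \<tau>_def sigma_fps_mult_nth case_prod_unfold
    by (simp only: sum.distrib sum_subtractf sum_distrib_left right_diff_distrib)
  also have "\<dots> = of_nat n * (\<Sum>d | d dvd n. \<alpha> * of_nat d + \<beta> * of_nat d ^ 3 + \<gamma> * of_nat d ^ 5)
    - (\<Sum>d | d dvd n. (let D = of_nat d in \<alpha> * (5 * D ^ 3 + D) / 6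
          + \<beta> * (21 * D ^ 5 + 10 * D ^ 3 - D) / 30
          + \<delta> * (D ^ 7 - D ^ 3) / 30
          + \<gamma> * (249 * D ^ 7 + 210 * D ^ 5 - 49 * D ^ 3 + 10 * D) / 420))"
    unfolding * by (rule sum_quads_binary_form[OF assms(1)])
  also have "\<dots> = of_nat n * (\<alpha> * \<sigma> 1 + \<beta> * \<sigma> 3 + \<gamma> * \<sigma> 5)
    - \<alpha> * (5 * \<sigma> 3 + \<sigma> 1) / 6 - \<beta> * (21 * \<sigma> 5 + 10 * \<sigma> 3 - \<sigma> 1) / 30
    - \<gamma> * (249 * \<sigma> 7 + 210 * \<sigma> 5 - 49 * \<sigma> 3 + 10 * \<sigma> 1) / 420 - \<delta> * (\<sigma> 7 - \<sigma> 3) / 30"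
    unfolding \<sigma>_def divisor_fps_nth Let_def
    by (simp add: sum.distrib sum_subtractf sum_distrib_left sum_divide_distrib
          add_divide_distrib diff_divide_distrib distrib_left right_diff_distrib ac_simps)
  finally show ?thesis .
qed

lemma fps_nth_numeral_mult: "fps_nth (numeral k * f) n = numeral k * fps_nth f n"
  for f :: "'a :: comm_ring_1 fps"
  by (simp add: numeral_fps_const)

text \<open>At each \<open>n > 0\<close> an equation is one instance of
  \<open>sigma_fps_relations\<close>: the quadratic form yields the one for \<open>P_fps\<close>,
  its square the one for \<open>Q_fps\<close>, and its cube together with
  \<open>(a * b * (a - b)) ^ 2\<close> the one for \<open>R_fps\<close>.\<close>

lemma Ramanujan_differential_equations:
  shows "12 * fps_XD P_fps = P_fps\<^sup>2 - (Q_fps :: 'a :: field_char_0 fps)"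
    and "3 * fps_XD Q_fps = P_fps * Q_fps - (R_fps :: 'a fps)"
    and "2 * fps_XD R_fps = P_fps * R_fps - (Q_fps :: 'a fps)\<^sup>2"
proof -
  let ?S = "sigma_fps :: nat \<Rightarrow> 'a fps"
  have "fps_nth (12 * fps_XD P_fps) n = fps_nth (P_fps\<^sup>2 - (Q_fps :: 'a fps)) n" for n
  proof (cases "n = 0")
    case False
    have eq: "P_fps\<^sup>2 - (Q_fps :: 'a fps) = 576 * (?S 1 * ?S 1) - 48 * ?S 1 - 240 * ?S 3"
      unfolding P_fps_def Q_fps_def by algebra
    have rhs: "fps_nth (P_fps\<^sup>2 - (Q_fps :: 'a fps)) n = 576 * fps_nth (?S 1 * ?S 1) n - 48 * fps_nth (?S 1) n - 240 * fps_nth (?S 3) n"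
      by (simp only: eq fps_sub_nth fps_add_nth fps_nth_numeral_mult)
    have lhs: "fps_nth (12 * fps_XD P_fps) n = 12 * (of_nat n * (- 24 * fps_nth (?S 1) n))"
      using False by (simp add: P_fps_def fps_nth_numeral_mult)
    show ?thesis
      unfolding lhs rhs using sigma_fps_relations[where n = n and \<alpha> = "1 :: 'a" and \<beta> = 0 and \<gamma> = 0 and \<delta> = 0] False
      by (simp add: field_simps) algebra
  qed (simp add: P_fps_def Q_fps_def fps_nth_numeral_mult power2_eq_square)
  then show "12 * fps_XD P_fps = P_fps\<^sup>2 - (Q_fps :: 'a fps)"
    by (rule fps_ext)
  have "fps_nth (3 * fps_XD Q_fps) n = fps_nth (P_fps * Q_fps - (R_fps :: 'a fps)) n" for n
  proof (cases "n = 0")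
    case False
    have eq: "P_fps * Q_fps - (R_fps :: 'a fps)
        = 504 * ?S 5 + 240 * ?S 3 - 24 * ?S 1 - 2880 * (?S 1 * ?S 3) - 2880 * (?S 3 * ?S 1)"
      unfolding P_fps_def Q_fps_def R_fps_def by algebra
    have rhs: "fps_nth (P_fps * Q_fps - (R_fps :: 'a fps)) n = 504 * fps_nth (?S 5) n + 240 * fps_nth (?S 3) n - 24 * fps_nth (?S 1) n
          - 2880 * fps_nth (?S 1 * ?S 3) n - 2880 * fps_nth (?S 3 * ?S 1) n"
      by (simp only: eq fps_sub_nth fps_add_nth fps_nth_numeral_mult)
    have lhs: "fps_nth (3 * fps_XD Q_fps) n = 3 * (of_nat n * (240 * fps_nth (?S 3) n))"
      using False by (simp add: Q_fps_def fps_nth_numeral_mult)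
    show ?thesis
      unfolding lhs rhs using sigma_fps_relations[where n = n and \<alpha> = "0 :: 'a" and \<beta> = 1 and \<gamma> = 0 and \<delta> = 0] False
      by (simp add: field_simps) algebra
  qed (simp add: P_fps_def Q_fps_def R_fps_def fps_nth_numeral_mult power2_eq_square)
  then show "3 * fps_XD Q_fps = P_fps * Q_fps - (R_fps :: 'a fps)"
    by (rule fps_ext)
  have "fps_nth (2 * fps_XD R_fps) n = fps_nth (P_fps * R_fps - (Q_fps :: 'a fps)\<^sup>2) n" for n
  proof (cases "n = 0")
    case False
    have eq: "P_fps * R_fps - (Q_fps :: 'a fps)\<^sup>2
        = 6048 * (?S 1 * ?S 5) + 6048 * (?S 5 * ?S 1) - 57600 * (?S 3 * ?S 3)
          - 24 * ?S 1 - 504 * ?S 5 - 480 * ?S 3"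
      unfolding P_fps_def Q_fps_def R_fps_def by algebra
    have rhs: "fps_nth (P_fps * R_fps - (Q_fps :: 'a fps)\<^sup>2) n = 6048 * fps_nth (?S 1 * ?S 5) n + 6048 * fps_nth (?S 5 * ?S 1) n
          - 57600 * fps_nth (?S 3 * ?S 3) n
          - 24 * fps_nth (?S 1) n - 504 * fps_nth (?S 5) n - 480 * fps_nth (?S 3) n"
      by (simp only: eq fps_sub_nth fps_add_nth fps_nth_numeral_mult)
    have lhs: "fps_nth (2 * fps_XD R_fps) n = 2 * (of_nat n * (- 504 * fps_nth (?S 5) n))"
      using False by (simp add: R_fps_def fps_nth_numeral_mult)
    \<comment> \<open>The ratio of \<gamma> to \<delta> removes the seventh-power divisor sum, as
      \<open>1008 * 249 / 420 = 17928 / 30\<close>; the scale gives the products the coefficients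
      6048 and -57600 found in \<open>rhs\<close>.\<close>
    show ?thesis
      unfolding lhs rhs using sigma_fps_relations[where n = n and \<alpha> = "0 :: 'a" and \<beta> = 0 and \<gamma> = "- 1008" and \<delta> = 17928] False
      by (simp add: field_simps) algebra
  qed (simp add: P_fps_def Q_fps_def R_fps_def fps_nth_numeral_mult power2_eq_square)
  then show "2 * fps_XD R_fps = P_fps * R_fps - (Q_fps :: 'a fps)\<^sup>2"
    by (rule fps_ext)
qed

lemma fps_XD_mult: "fps_XD (f * g) = f * fps_XD g + fps_XD f * g"
  for f g :: "'a :: comm_ring_1 fps"
  by (simp add: fps_XD_def algebra_simps)

lemma fps_XD_diff: "fps_XD (f - g) = fps_XD f - fps_XD g"
  for f g :: "'a :: comm_ring_1 fps"
  by (simp add: fps_XD_def algebra_simps)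

lemma fps_XD_numeral: "fps_XD (numeral k :: 'a :: comm_ring_1 fps) = 0"
  by (simp add: fps_XD_def)

lemma fps_XD_1: "fps_XD (1 :: 'a :: comm_ring_1 fps) = 0"
  by (simp add: fps_XD_def)

lemma fps_XD_compose:
  fixes f :: "'a :: idom fps"
  assumes "fps_nth g 0 = 0"
  shows "fps_XD (f oo g) = (fps_deriv f oo g) * fps_XD g"
  by (simp add: fps_XD_def fps_compose_deriv[OF assms] algebra_simps)

lemma fps_nth_0_PQR [simp]: "fps_nth P_fps 0 = 1" "fps_nth Q_fps 0 = 1" "fps_nth R_fps 0 = 1"
  by (simp_all add: P_fps_def Q_fps_def R_fps_def fps_nth_numeral_mult)

subsection \<open>The discriminant\<close>

text \<open>The discriminant enters through \<open>E\<^sub>4\<close> and \<open>E\<^sub>6\<close>,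
  where the differential equations apply; its agreement with the infinite product is
  \<open>Delta_fps_expansion\<close>.\<close>

definition Delta_fps :: "'a :: field_char_0 fps" where
  "Delta_fps = fps_const (1 / 1728) * (Q_fps ^ 3 - R_fps\<^sup>2)"

lemma Delta_fps: "1728 * Delta_fps = Q_fps ^ 3 - (R_fps :: 'a :: field_char_0 fps)\<^sup>2"
proof -
  have "(1728 :: 'a fps) * fps_const (1 / 1728) = 1"
    by (simp add: numeral_fps_const flip: fps_const_1_eq_1)
  then show ?thesis
    unfolding Delta_fps_def by algebra
qed

lemma fps_nth_0_Delta_fps [simp]: "fps_nth Delta_fps 0 = 0"
  by (simp add: Delta_fps_def fps_power_zeroth)

text \<open>In \<open>3 * Q\<^sup>2 * D Q - 2 * R * D R\<close> the two cross terms
  \<open>Q\<^sup>2 * R\<close> cancel and \<open>P\<close> factors out.\<close>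

lemma fps_XD_Delta_fps: "fps_XD Delta_fps = P_fps * (Delta_fps :: 'a :: field_char_0 fps)"
proof -
  have "1728 * fps_XD (Delta_fps :: 'a fps) = fps_XD (1728 * Delta_fps)"
    by (simp add: fps_XD_mult fps_XD_numeral)
  also have "\<dots> = 3 * Q_fps\<^sup>2 * fps_XD Q_fps - 2 * R_fps * fps_XD R_fps"
    unfolding Delta_fps by (simp add: fps_XD_diff power2_eq_square power3_eq_cube fps_XD_mult algebra_simps)
  also have "\<dots> = P_fps * (Q_fps ^ 3 - R_fps\<^sup>2)"
    using Ramanujan_differential_equations(2,3)[where ?'a = 'a] by algebra
  also have "\<dots> = 1728 * (P_fps * Delta_fps)"
    unfolding Delta_fps[symmetric] by algebra
  finally show ?thesis
    by simp
qed

section \<open>Power series with integral coefficients\<close>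

definition fps_integral_coeffs :: "'a :: ring_1 fps \<Rightarrow> bool" where
  "fps_integral_coeffs f \<longleftrightarrow> (\<forall>n. fps_nth f n \<in> \<int>)"

lemma fps_integral_coeffs_intros:
  fixes f g :: "'a :: comm_ring_1 fps"
  shows "fps_integral_coeffs f \<Longrightarrow> fps_integral_coeffs g \<Longrightarrow> fps_integral_coeffs (f + g)"
    and "fps_integral_coeffs f \<Longrightarrow> fps_integral_coeffs g \<Longrightarrow> fps_integral_coeffs (f - g)"
    and "fps_integral_coeffs f \<Longrightarrow> fps_integral_coeffs g \<Longrightarrow> fps_integral_coeffs (f * g)"
    and "fps_integral_coeffs (1 :: 'a fps)"
    and "fps_integral_coeffs (numeral k :: 'a fps)"
  by (auto simp: fps_integral_coeffs_def fps_mult_nth numeral_fps_const intro!: Ints_sum Ints_mult)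

lemma fps_integral_coeffs_power:
  "fps_integral_coeffs f \<Longrightarrow> fps_integral_coeffs (f ^ n)" for f :: "'a :: comm_ring_1 fps"
  by (induction n) (auto intro: fps_integral_coeffs_intros)

lemma fps_integral_coeffs_compose:
  "fps_integral_coeffs f \<Longrightarrow> fps_integral_coeffs g \<Longrightarrow> fps_integral_coeffs (f oo g)"
  for f g :: "'a :: comm_ring_1 fps"
  using fps_integral_coeffs_power[of g]
  by (auto simp: fps_integral_coeffs_def fps_compose_nth intro!: Ints_sum Ints_mult)

lemma fps_integral_coeffs_inverse:
  fixes f :: "'a :: field fps"
  assumes "fps_integral_coeffs f" "fps_nth f 0 = 1"
  shows "fps_integral_coeffs (inverse f)"
  unfolding fps_integral_coeffs_def
proof
  fix n
  show "fps_nth (inverse f) n \<in> \<int>"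
  proof (induction n rule: less_induct)
    case (less n)
    have "fps_nth (inverse f) n = 1" if "n = 0"
      using that assms(2) by simp
    moreover have "fps_nth (inverse f) n = - (\<Sum>i=1..n. fps_nth f i * fps_nth (inverse f) (n - i))" if "n > 0"
    proof -
      have "0 = fps_nth (f * inverse f) n"
        using that assms(2) inverse_mult_eq_1'[of f] by simp
      also have "\<dots> = (\<Sum>i=0..n. fps_nth f i * fps_nth (inverse f) (n - i))"
        by (rule fps_mult_nth)
      also have "\<dots> = fps_nth (inverse f) n + (\<Sum>i=1..n. fps_nth f i * fps_nth (inverse f) (n - i))"
        using assms(2) by (simp add: sum.atLeast_Suc_atMost)
      finally show ?thesis
        by (simp add: eq_neg_iff_add_eq_0)
    qed
    ultimately show ?case
      using less assms(1) by (cases "n = 0") (auto simp: fps_integral_coeffs_def intro!: Ints_sum Ints_mult)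
  qed
qed

lemma fps_integral_coeffs_sigma_fps: "fps_integral_coeffs (sigma_fps k)"
  by (auto simp: fps_integral_coeffs_def divisor_fps_nth intro!: Ints_sum Ints_power)

lemma fps_integral_coeffs_Q_fps: "fps_integral_coeffs Q_fps"
  unfolding Q_fps_def by (intro fps_integral_coeffs_intros fps_integral_coeffs_sigma_fps)

text \<open>Needed for the integrality of the discriminant: the linear part of
  \<open>Q\<^sup>3 - R\<^sup>2\<close> supplies only the factor 144 of
  \<open>1728 = 144 * 12\<close>. The remaining 12 is checked residue by residue.\<close>

lemma twelve_dvd: "12 dvd 5 * d ^ 3 + 7 * d ^ 5" for d :: nat
proof -
  have red: "(5 * e ^ 3 + 7 * e ^ 5) mod 12 =
      (5 * (e ^ 3 mod 12) mod 12 + 7 * (e ^ 5 mod 12) mod 12) mod 12" for e :: nat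
    by (simp only: mod_add_eq mod_mult_right_eq)
  have "d mod 12 < 12"
    by simp
  then have "d mod 12 \<in> {0, 1, 2, 3, 4, 5, 6, 7, 8, 9, 10, 11}"
    unfolding insert_iff empty_iff by presburger
  then have "(5 * (d mod 12) ^ 3 + 7 * (d mod 12) ^ 5) mod 12 = 0"
    by (elim insertE) auto
  moreover have "(5 * (d mod 12) ^ 3 + 7 * (d mod 12) ^ 5) mod 12 = (5 * d ^ 3 + 7 * d ^ 5) mod 12"
    by (simp only: red[of d] red[of "d mod 12"] power_mod)
  ultimately show ?thesis
    by (simp add: dvd_eq_mod_eq_0)
qed

lemma fps_integral_coeffs_Delta_fps: "fps_integral_coeffs (Delta_fps :: 'a :: field_char_0 fps)"
proof -
  let ?X = "sigma_fps 3 :: 'a fps" and ?Y = "sigma_fps 5 :: 'a fps"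
  let ?Z = "divisor_fps (\<lambda>d. of_nat ((5 * d ^ 3 + 7 * d ^ 5) div 12)) :: 'a fps"
  have Z: "12 * ?Z = 5 * ?X + 7 * ?Y"
  proof (rule fps_ext)
    fix n
    have "12 * of_nat ((5 * d ^ 3 + 7 * d ^ 5) div 12) = (5 * of_nat d ^ 3 + 7 * of_nat d ^ 5 :: 'a)" for d
    proof -
      have "12 * ((5 * d ^ 3 + 7 * d ^ 5) div 12) = 5 * d ^ 3 + 7 * d ^ 5"
        using twelve_dvd[of d] by (rule dvd_mult_div_cancel)
      then have "(of_nat (12 * ((5 * d ^ 3 + 7 * d ^ 5) div 12)) :: 'a) = of_nat (5 * d ^ 3 + 7 * d ^ 5)"
        by (rule arg_cong)
      then show ?thesis
        by simp
    qed
    then show "fps_nth (12 * ?Z) n = fps_nth (5 * ?X + 7 * ?Y) n"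
      by (simp add: fps_nth_numeral_mult divisor_fps_nth sum_distrib_left sum.distrib)
  qed
  \<comment> \<open>\<open>Q\<^sup>3 - R\<^sup>2\<close> for \<open>Q = 1 + 240 X\<close>, \<open>R = 1 - 504 Y\<close> has linear part \<open>144 (5 X + 7 Y)\<close>.\<close>
  have "1728 * Delta_fps = 1728 * (?Z + 100 * ?X\<^sup>2 + 8000 * ?X ^ 3 - 147 * ?Y\<^sup>2)"
    unfolding Delta_fps Q_fps_def R_fps_def using Z by algebra
  then have eq: "Delta_fps = ?Z + 100 * ?X\<^sup>2 + 8000 * ?X ^ 3 - 147 * ?Y\<^sup>2"
    by (subst (asm) mult_left_cancel) simp_all
  have Z_int: "fps_integral_coeffs ?Z"
    by (auto simp: fps_integral_coeffs_def divisor_fps_nth intro!: Ints_sum)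
  show ?thesis
    unfolding eq by (intro fps_integral_coeffs_intros fps_integral_coeffs_power fps_integral_coeffs_sigma_fps Z_int)
qed

subsection \<open>The hypergeometric expansion of the square root of \<open>E\<^sub>4\<close>\<close>

text \<open>The coefficients of the hypergeometric series 3F2(1/6, 1/2, 5/6; 1, 1; 1728 t).\<close>

definition hyp_coeff :: "nat \<Rightarrow> 'a :: field_char_0" where
  "hyp_coeff k = fact (6 * k) / (fact (3 * k) * fact k ^ 3)"

lemma hyp_coeff_Suc:
  "of_nat (Suc k) ^ 3 * hyp_coeff (Suc k) =
     24 * (6 * of_nat k + 1) * (2 * of_nat k + 1) * (6 * of_nat k + 5) * (hyp_coeff k :: 'a :: field_char_0)"
proof -
  define K where "K = (of_nat k :: 'a)"
  have 6: "6 * Suc k = Suc (Suc (Suc (Suc (Suc (Suc (6 * k))))))" and 3: "3 * Suc k = Suc (Suc (Suc (3 * k)))"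
    by simp_all
  have f6: "(fact (6 * Suc k) :: 'a) = 72 * (K + 1) * (6 * K + 5) * (3 * K + 2) * (2 * K + 1) * (3 * K + 1) * (6 * K + 1)
      * fact (6 * k)"
    unfolding 6 fact_Suc K_def by (simp add: algebra_simps)
  have f3: "(fact (3 * Suc k) :: 'a) = 3 * (K + 1) * (3 * K + 2) * (3 * K + 1) * fact (3 * k)"
    unfolding 3 fact_Suc K_def by (simp add: algebra_simps)
  have f1: "(fact (Suc k) :: 'a) = (K + 1) * fact k" "of_nat (Suc k) = K + 1"
    by (simp_all add: K_def)
  have "of_nat (Suc k) \<noteq> (0 :: 'a)" "of_nat (Suc (3 * k)) \<noteq> (0 :: 'a)" "of_nat (Suc (Suc (3 * k))) \<noteq> (0 :: 'a)"
    by (simp_all only: of_nat_eq_0_iff)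
  then have nz: "K + 1 \<noteq> 0" "3 * K + 1 \<noteq> 0" "3 * K + 2 \<noteq> 0"
    by (simp_all add: K_def ac_simps)
  then have "3 * K + 3 \<noteq> 0"
    using mult_eq_0_iff[of 3 "K + 1"] by (simp add: distrib_left)
  show ?thesis
    unfolding hyp_coeff_def f6 f3 f1 K_def[symmetric] using nz \<open>3 * K + 3 \<noteq> 0\<close>
    by (simp add: divide_simps power_mult_distrib) (simp add: algebra_simps)
qed

definition hyp_fps :: "'a :: field_char_0 fps" where "hyp_fps = Abs_fps hyp_coeff"

text \<open>The recurrence \<open>hyp_coeff_Suc\<close> in operator form, with
  \<open>(6k + 1)(2k + 1)(6k + 5) = 72k^3 + 108k^2 + 46k + 5\<close>.\<close>

lemma hyp_fps_equation:
  fixes f :: "'a :: field_char_0 fps"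
  defines "f \<equiv> hyp_fps"
  shows "(fps_XD ^^ 3) f = 24 * fps_X * (72 * (fps_XD ^^ 3) f + 108 * (fps_XD ^^ 2) f + 46 * fps_XD f + 5 * f)"
proof (rule fps_ext)
  fix n
  show "fps_nth ((fps_XD ^^ 3) f) n =
    fps_nth (24 * fps_X * (72 * (fps_XD ^^ 3) f + 108 * (fps_XD ^^ 2) f + 46 * fps_XD f + 5 * f)) n"
  proof (cases n)
    case (Suc k)
    have "fps_nth ((fps_XD ^^ 3) f) n = of_nat (Suc k) ^ 3 * hyp_coeff (Suc k)"
      by (simp add: Suc f_def hyp_fps_def fps_mult_fps_XD_shift del: of_nat_Suc)
    also have "\<dots> = 24 * (6 * of_nat k + 1) * (2 * of_nat k + 1) * (6 * of_nat k + 5) * hyp_coeff k"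
      by (rule hyp_coeff_Suc)
    also have "\<dots> = fps_nth (24 * fps_X * (72 * (fps_XD ^^ 3) f + 108 * (fps_XD ^^ 2) f + 46 * fps_XD f + 5 * f)) n"
      by (simp add: Suc f_def hyp_fps_def fps_mult_fps_XD_shift fps_nth_numeral_mult mult.assoc)
         algebra
    finally show ?thesis .
  qed (simp add: fps_mult_fps_XD_shift)
qed

section \<open>The hypergeometric equation in the local parameter \<open>1 / j\<close>\<close>

lemma fps_mult_nth_leading:
  fixes f g :: "'a :: comm_ring_1 fps"
  assumes "\<And>i. i < n \<Longrightarrow> fps_nth f i = 0"
  shows "fps_nth (g * f) n = fps_nth g 0 * fps_nth f n"
proof -
  have "fps_nth (g * f) n = (\<Sum>i=0..n. fps_nth g i * fps_nth f (n - i))"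
    by (rule fps_mult_nth)
  also have "\<dots> = (\<Sum>i\<in>{0}. fps_nth g i * fps_nth f (n - i))"
    by (rule sum.mono_neutral_right) (use assms in auto)
  finally show ?thesis
    by simp
qed

text \<open>This is \<open>t d/dt\<close> for the local parameter \<open>t = 1 / j\<close> introduced next.\<close>

definition theta_fps :: "'a :: field_char_0 fps \<Rightarrow> 'a fps" where
  "theta_fps f = Q_fps * inverse R_fps * fps_XD f"

definition t_fps :: "'a :: field_char_0 fps" where
  "t_fps = Delta_fps * inverse (Q_fps ^ 3)"

lemma R_fps_inverse: "R_fps * inverse R_fps = (1 :: 'a :: field_char_0 fps)"
  by (rule inverse_mult_eq_1') simp

lemma t_fps_mult_Q_fps: "t_fps * Q_fps ^ 3 = Delta_fps"
proof -
  have "Q_fps ^ 3 * inverse (Q_fps ^ 3) = (1 :: 'a :: field_char_0 fps)"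
    by (rule inverse_mult_eq_1') (simp add: fps_power_zeroth)
  then show ?thesis
    unfolding t_fps_def by algebra
qed

lemma fps_nth_0_t_fps [simp]: "fps_nth t_fps 0 = 0"
  by (simp add: t_fps_def)

lemma fps_integral_coeffs_t_fps: "fps_integral_coeffs t_fps"
  unfolding t_fps_def
  by (intro fps_integral_coeffs_intros fps_integral_coeffs_inverse fps_integral_coeffs_power
        fps_integral_coeffs_Delta_fps fps_integral_coeffs_Q_fps)
     (simp add: fps_power_zeroth)

lemma Q_fps_nonzero: "Q_fps \<noteq> (0 :: 'a :: field_char_0 fps)"
proof
  assume "Q_fps = (0 :: 'a fps)"
  then have "fps_nth (Q_fps :: 'a fps) 0 = 0"
    by simp
  then show False
    by simp
qed

text \<open>Logarithmic differentiation of \<open>t_fps * Q_fps ^ 3 = Delta_fps\<close>: the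
  contributions of \<open>P_fps\<close> cancel and only \<open>R_fps / Q_fps\<close>
  remains.\<close>

lemma fps_XD_t_fps: "Q_fps * fps_XD t_fps = t_fps * (R_fps :: 'a :: field_char_0 fps)"
proof -
  let ?t = "t_fps :: 'a fps" and ?Q = "Q_fps :: 'a fps"
  have "fps_XD (?t * ?Q ^ 3) = P_fps * (?t * ?Q ^ 3)"
    unfolding t_fps_mult_Q_fps by (rule fps_XD_Delta_fps)
  then have "fps_XD ?t * ?Q ^ 3 + ?t * (3 * ?Q\<^sup>2 * fps_XD ?Q) = P_fps * (?t * ?Q ^ 3)"
    by (simp add: fps_XD_mult power2_eq_square power3_eq_cube algebra_simps)
  then have "?Q\<^sup>2 * (?Q * fps_XD ?t) = ?Q\<^sup>2 * (?t * R_fps)"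
    using Ramanujan_differential_equations(2)[where ?'a = 'a] by algebra
  then show ?thesis
    by (simp add: Q_fps_nonzero)
qed

text \<open>By the chain rule this amounts to \<open>theta_fps t_fps = t_fps\<close>, which is
  \<open>fps_XD_t_fps\<close> divided by \<open>R_fps\<close>.\<close>

lemma theta_fps_compose:
  fixes f :: "'a :: field_char_0 fps"
  shows "theta_fps (f oo t_fps) = fps_XD f oo t_fps"
proof -
  have "fps_XD f oo t_fps = t_fps * (fps_deriv f oo t_fps)"
    by (simp add: fps_XD_def fps_compose_mult_distrib)
  then show ?thesis
    unfolding theta_fps_def fps_XD_compose[OF fps_nth_0_t_fps]
    using fps_XD_t_fps[where ?'a = 'a] R_fps_inverse[where ?'a = 'a] by algebra
qed

lemma theta_fps_mult: "theta_fps (f * g) = f * theta_fps g + theta_fps f * g"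
  by (simp add: theta_fps_def fps_XD_mult algebra_simps)

lemma theta_fps_add: "theta_fps (f + g) = theta_fps f + theta_fps g"
  by (simp add: theta_fps_def algebra_simps)

lemma theta_fps_diff: "theta_fps (f - g) = theta_fps f - theta_fps g"
  by (simp add: theta_fps_def fps_XD_diff algebra_simps)

lemma theta_fps_uminus: "theta_fps (- f) = - theta_fps f"
  by (simp add: theta_fps_def fps_XD_def)

lemma theta_fps_numeral: "theta_fps (numeral k) = 0" "theta_fps 1 = 0"
  by (simp_all add: theta_fps_def fps_XD_numeral fps_XD_1)

text \<open>The equation of \<open>hyp_fps\<close> with \<open>fps_XD\<close> replaced by
  \<open>theta_fps\<close>, so that it can be tested on a series in \<open>q\<close> not yet known
  to be a series in \<open>t_fps\<close>.\<close>

definition solves_hyp_equation :: "'a :: field_char_0 fps \<Rightarrow> bool" where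
  "solves_hyp_equation f \<longleftrightarrow> (let f1 = theta_fps f; f2 = theta_fps f1; f3 = theta_fps f2
     in f3 = 24 * t_fps * (72 * f3 + 108 * f2 + 46 * f1 + 5 * f))"

lemma solves_hyp_equation_diff:
  "solves_hyp_equation f \<Longrightarrow> solves_hyp_equation g \<Longrightarrow> solves_hyp_equation (f - g)"
  unfolding solves_hyp_equation_def Let_def theta_fps_diff by algebra

lemma solves_hyp_equation_compose: "solves_hyp_equation (hyp_fps oo t_fps)"
proof -
  have X: "fps_X oo t_fps = (t_fps :: 'a fps)"
    by simp
  have num: "(numeral k oo t_fps) = (numeral k :: 'a fps)" for k
    by (simp add: numeral_fps_const)
  from arg_cong[OF hyp_fps_equation, of "\<lambda>f. f oo (t_fps :: 'a fps)"] show ?thesis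
    unfolding solves_hyp_equation_def Let_def theta_fps_compose
    by (simp add: fps_compose_mult_distrib fps_compose_add_distrib num numeral_3_eq_3 numeral_2_eq_2)
qed

text \<open>Since \<open>Q_fps / R_fps\<close> has constant term 1, \<open>theta_fps\<close>
  multiplies the leading coefficient, of index \<open>n\<close>, by \<open>n\<close>. The right-hand
  side has the factor \<open>t_fps\<close> and starts later, so \<open>n ^ 3\<close> times the
  leading coefficient is 0 although \<open>n > 0\<close>.\<close>

lemma solves_hyp_equation_eq_0:
  fixes f :: "'a :: field_char_0 fps"
  assumes "solves_hyp_equation f" "fps_nth f 0 = 0"
  shows "f = 0"
proof (rule ccontr)
  assume "f \<noteq> 0"
  define n where "n = subdegree f"
  have n: "fps_nth f n \<noteq> 0" "\<And>i. i < n \<Longrightarrow> fps_nth f i = 0"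
    using \<open>f \<noteq> 0\<close> by (auto simp: n_def)
  then have "n > 0"
    using assms(2) by (cases n) auto
  have theta: "fps_nth (theta_fps g) m = of_nat m * fps_nth g m"
    if "m \<le> n" "\<And>i. i < m \<Longrightarrow> fps_nth g i = 0" for g :: "'a fps" and m
    unfolding theta_fps_def by (subst fps_mult_nth_leading) (use that in simp_all)
  have low: "fps_nth (theta_fps g) i = 0" if "\<And>i. i < n \<Longrightarrow> fps_nth g i = 0" "i < n" for g :: "'a fps" and i
    using that by (subst theta) auto
  define f1 f2 f3 where "f1 = theta_fps f" and "f2 = theta_fps f1" and "f3 = theta_fps f2"
  note defs = f1_def f2_def f3_def
  have lows: "fps_nth f1 i = 0" "fps_nth f2 i = 0" "fps_nth f3 i = 0" if "i < n" for i
    unfolding defs using n(2) that by (blast intro: low)+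
  have lead: "fps_nth f3 n = of_nat n ^ 3 * fps_nth f n"
    unfolding defs by (simp add: theta low n(2) power3_eq_cube)
  have "f3 = (24 * t_fps) * (72 * f3 + 108 * f2 + 46 * f1 + 5 * f)"
    using assms(1) by (simp add: solves_hyp_equation_def Let_def defs)
  then have "fps_nth f3 n = fps_nth ((24 * t_fps) * (72 * f3 + 108 * f2 + 46 * f1 + 5 * f)) n"
    by (rule arg_cong)
  also have "\<dots> = 0"
    by (subst fps_mult_nth_leading) (simp_all add: lows n(2) fps_nth_numeral_mult)
  finally show False
    using lead n(1) \<open>n > 0\<close> by simp
qed

text \<open>With \<open>Z = P * Q / R\<close> and
  \<open>Y = Q ^ 3 / R\<^sup>2 = 1 / (1 - 1728 t)\<close>, polynomials in \<open>Z\<close> and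
  \<open>Y\<close> are closed under \<open>theta_fps\<close>, and
  \<open>theta_fps H = (Z - 1) / 6 * H\<close>. All derivatives of \<open>H\<close> are thus
  polynomial multiples of \<open>H\<close>, and the equation becomes a polynomial identity in
  \<open>Z\<close> and \<open>Y\<close>.\<close>

lemma sqrt_Q_fps_solves_hyp_equation:
  fixes H :: "'a :: field_char_0 fps"
  assumes H: "H\<^sup>2 = Q_fps"
  shows "solves_hyp_equation H"
proof -
  define P Q R where "P = (P_fps :: 'a fps)" and "Q = (Q_fps :: 'a fps)" and "R = (R_fps :: 'a fps)"
  define r where "r = inverse R"
  note ram = Ramanujan_differential_equations[where ?'a = 'a, folded P_def Q_def R_def]
  have Rr: "R * r = 1"
    unfolding R_def r_def by (rule R_fps_inverse)
  have th: "theta_fps f = Q * r * fps_XD f" for f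
    by (simp add: theta_fps_def Q_def R_def r_def)
  have "0 = fps_XD (R * r)"
    by (simp add: Rr fps_XD_1)
  also have "\<dots> = R * fps_XD r + fps_XD R * r"
    by (rule fps_XD_mult)
  finally have Dr: "2 * fps_XD r = - P * r + Q\<^sup>2 * r\<^sup>2"
    using ram(3) Rr by algebra
  define Z Y where "Z = P * Q * r" and "Y = Q ^ 3 * r\<^sup>2"
  have "12 * fps_XD Z = 12 * fps_XD P * Q * r + 4 * P * (3 * fps_XD Q) * r + 6 * P * Q * (2 * fps_XD r)"
    unfolding Z_def fps_XD_mult by algebra
  also have "\<dots> = (P\<^sup>2 - Q) * Q * r + 4 * P * (P * Q - R) * r + 6 * P * Q * (- P * r + Q\<^sup>2 * r\<^sup>2)"
    unfolding ram Dr ..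
  finally have DZ: "12 * fps_XD Z = \<dots>" .
  have Zeq: "12 * theta_fps Z = - (Z\<^sup>2) - Y - 4 * Z + 6 * Z * Y"
  proof -
    have "12 * theta_fps Z = Q * r * (12 * fps_XD Z)"
      unfolding th by algebra
    also have "\<dots> = - (Z\<^sup>2) - Y - 4 * Z + 6 * Z * Y"
      unfolding DZ unfolding Z_def Y_def using Rr by algebra
    finally show ?thesis .
  qed
  have Yeq: "theta_fps Y = Y\<^sup>2 - Y"
  proof -
    have "fps_XD Y = Q\<^sup>2 * (3 * fps_XD Q) * r\<^sup>2 + Q ^ 3 * r * (2 * fps_XD r)"
      unfolding Y_def by (simp add: fps_XD_mult power2_eq_square power3_eq_cube algebra_simps)
    also have "\<dots> = Q\<^sup>2 * (P * Q - R) * r\<^sup>2 + Q ^ 3 * r * (- P * r + Q\<^sup>2 * r\<^sup>2)"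
      unfolding ram Dr ..
    finally show ?thesis
      unfolding th Y_def using Rr by algebra
  qed
  have tY: "1728 * t_fps * Y = Y - 1"
  proof -
    have "1728 * t_fps * Y = r\<^sup>2 * (1728 * Delta_fps)"
      unfolding Y_def Q_def t_fps_mult_Q_fps[symmetric] by algebra
    also have "\<dots> = Y - 1"
      unfolding Delta_fps Y_def Q_def[symmetric] R_def[symmetric] using Rr by algebra
    finally show ?thesis .
  qed
  define h1 h2 h3 where "h1 = theta_fps H" and "h2 = theta_fps h1" and "h3 = theta_fps h2"
  have "2 * H * fps_XD H = fps_XD Q"
    using arg_cong[OF H, of fps_XD] by (simp add: power2_eq_square fps_XD_mult Q_def algebra_simps)
  then have "3 * (2 * H * fps_XD H) = P * Q - R"
    by (simp only: ram(2))
  then have DH: "6 * H * fps_XD H = P * Q - R"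
    by (simp add: mult.assoc)
  have "Q * (6 * h1) = Q * r * H * (6 * H * fps_XD H)"
    unfolding h1_def th H[folded Q_def, symmetric] by (simp add: power2_eq_square ac_simps)
  also have "\<dots> = Q * ((Z - 1) * H)"
    unfolding DH Z_def using Rr by algebra
  finally have "Q * (6 * h1) = Q * ((Z - 1) * H)" .
  then have h1: "6 * h1 = (Z - 1) * H"
    by (simp add: Q_def Q_fps_nonzero)
  have h2: "6 * h2 = (Z - 1) * h1 + theta_fps Z * H"
    using arg_cong[OF h1, of theta_fps]
    by (simp add: theta_fps_mult theta_fps_diff theta_fps_numeral h1_def h2_def)
  have h3: "6 * h3 = (Z - 1) * h2 + 2 * theta_fps Z * h1 + theta_fps (theta_fps Z) * H"
    using arg_cong[OF h2, of theta_fps]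
    by (simp add: theta_fps_mult theta_fps_diff theta_fps_add theta_fps_numeral h1_def h2_def h3_def
        algebra_simps)
  have Z2: "12 * theta_fps (theta_fps Z) =
      - 2 * Z * theta_fps Z - theta_fps Y - 4 * theta_fps Z + 6 * (Z * theta_fps Y + theta_fps Z * Y)"
    using arg_cong[OF Zeq, of theta_fps]
    by (simp add: theta_fps_mult theta_fps_diff theta_fps_add theta_fps_numeral power2_eq_square
        theta_fps_uminus algebra_simps)
  define U V where "U = theta_fps Z" and "V = theta_fps U"
  note h2 = h2[folded U_def] and h3 = h3[folded U_def V_def] and Z2 = Z2[folded U_def V_def]
    and Zeq = Zeq[folded U_def]
  \<comment> \<open>Integral forms of the multipliers: \<open>p1 * H\<close> is
    \<open>6 * h1\<close>, \<open>p2 * H\<close> is \<open>72 * h2\<close>, while \<open>A\<close>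
    and \<open>B\<close> are \<open>12 * U\<close> and \<open>144 * V\<close>.\<close>
  define p1 A where "p1 = Z - 1" and "A = - (Z\<^sup>2) - Y - 4 * Z + 6 * Z * Y"
  define p2 where "p2 = 2 * p1\<^sup>2 + A"
  define B where "B = - 2 * Z * A - 12 * (Y\<^sup>2 - Y) - 4 * A + 6 * (12 * (Z * (Y\<^sup>2 - Y)) + A * Y)"
  have 1: "6 * h1 = p1 * H"
    by (simp add: h1 p1_def)
  have 2: "72 * h2 = p2 * H"
  proof -
    have "72 * h2 = 2 * p1 * (6 * h1) + 12 * U * H"
      using h2 unfolding p1_def by algebra
    then show ?thesis
      unfolding Zeq A_def[symmetric] 1 p2_def by algebra
  qed
  have B: "144 * V = B"
  proof -
    have "144 * V = - 2 * Z * (12 * U) - 12 * theta_fps Y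
        - 4 * (12 * U) + 6 * (12 * (Z * theta_fps Y) + (12 * U) * Y)"
      using Z2 by algebra
    then show ?thesis
      unfolding Zeq Yeq A_def[symmetric] B_def .
  qed
  have "864 * h3 = 2 * p1 * (72 * h2) + 4 * (12 * U) * (6 * h1) + 144 * V * H"
    using h3 unfolding p1_def by algebra
  also have "\<dots> = 2 * p1 * (p2 * H) + 4 * A * (p1 * H) + B * H"
    unfolding B 1 2 unfolding Zeq A_def ..
  also have "\<dots> = (2 * p1 * p2 + 4 * A * p1 + B) * H"
    by (simp add: algebra_simps)
  \<comment> \<open>The factor \<open>Y - 1 = 1728 * t_fps * Y\<close> appears because the equation,
    solved for the third derivative, reads
    \<open>72 * h3 = (Y - 1) * (108 * h2 + 46 * h1 + 5 * H)\<close>.\<close>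
  also have "2 * p1 * p2 + 4 * A * p1 + B = (Y - 1) * (18 * p2 + 92 * p1 + 60)"
    unfolding B_def p2_def unfolding p1_def A_def by (simp add: algebra_simps power2_eq_square)
  also have "\<dots> * H = (Y - 1) * (18 * (p2 * H) + 92 * (p1 * H) + 60 * H)"
    by (simp add: algebra_simps)
  also have "\<dots> = 12 * ((Y - 1) * (108 * h2 + 46 * h1 + 5 * H))"
    unfolding 1[symmetric] 2[symmetric] by algebra
  finally have "12 * (72 * h3) = 12 * ((Y - 1) * (108 * h2 + 46 * h1 + 5 * H))"
    by simp
  then have "72 * h3 = (Y - 1) * (108 * h2 + 46 * h1 + 5 * H)"
    by (subst (asm) mult_left_cancel) simp_all
  then have "72 * (Y * h3) = 72 * (Y * (24 * t_fps * (72 * h3 + 108 * h2 + 46 * h1 + 5 * H)))"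
    using tY by algebra
  moreover have "Y \<noteq> 0"
    by (auto simp: Y_def Q_def r_def R_def Q_fps_nonzero)
  ultimately have "h3 = 24 * t_fps * (72 * h3 + 108 * h2 + 46 * h1 + 5 * H)"
    by (metis mult_left_cancel zero_neq_numeral)
  then show ?thesis
    unfolding solves_hyp_equation_def Let_def h3_def h2_def h1_def .
qed

lemma sqrt_Q_fps_eq_hyp_fps_compose:
  fixes H :: "'a :: field_char_0 fps"
  assumes "H\<^sup>2 = Q_fps" "fps_nth H 0 = 1"
  shows "H = hyp_fps oo t_fps"
proof -
  have "H - (hyp_fps oo t_fps) = 0"
    using sqrt_Q_fps_solves_hyp_equation[OF assms(1)] solves_hyp_equation_compose assms(2)
    by (intro solves_hyp_equation_eq_0 solves_hyp_equation_diff)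
       (simp_all add: hyp_fps_def hyp_coeff_def)
  then show ?thesis
    by simp
qed

subsection \<open>An integral antiderivative\<close>

lemma inverse_linear_power_nth:
  fixes c :: "'a :: field_char_0"
  shows "fps_nth (inverse (1 + fps_const c * fps_X) ^ Suc m) j = of_nat (m + j choose m) * (- c) ^ j"
proof -
  have "inverse (1 + fps_const c * fps_X) ^ Suc m = inverse ((1 - fps_const (- c) * fps_X) ^ Suc m)"
    by (simp only: fps_inverse_power) (simp flip: fps_const_neg)
  also have "fps_nth \<dots> j = fps_nth (fps_binomial (- of_nat (Suc m)) oo (fps_const c * fps_X)) j"
    unfolding one_minus_fps_X_const_neg_power by simp
  also have "\<dots> = c ^ j * ((- of_nat (Suc m)) gchoose j)"
    by (simp add: fps_compose_linear del: of_nat_Suc)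
  also have "(- of_nat (Suc m) :: 'a) gchoose j = (- 1) ^ j * of_nat (m + j choose j)"
    unfolding gbinomial_minus by (simp add: binomial_gbinomial)
  also have "m + j choose j = m + j choose m"
    using binomial_symmetric[of j "m + j"] by simp
  finally show ?thesis
    by (simp add: power_minus[of c] algebra_simps)
qed

definition fuss_catalan :: "nat \<Rightarrow> nat" where
  "fuss_catalan k = (3 * k choose k) div (2 * k + 1)"

text \<open>The division in the definition is exact: \<open>2k + 1\<close> divides
  \<open>(3k + 1) * (3k choose k)\<close> by absorption and is coprime to \<open>3k + 1\<close>, as
  \<open>3(2k + 1) - 2(3k + 1) = 1\<close>.\<close>

lemma fuss_catalan: "(2 * k + 1) * fuss_catalan k = 3 * k choose k"
proof -
  have "(2 * k + 1) * (3 * k + 1 choose k) = (3 * k + 1) * (3 * k choose k)"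
    using binomial_absorb_comp[of "3 * k + 1" k] by simp
  then have "(2 * k + 1) dvd (3 * k + 1) * (3 * k choose k)"
    by (rule dvdI[OF sym])
  moreover have "coprime (2 * k + 1) (3 * k + 1)"
  proof (rule coprimeI)
    fix d assume d: "d dvd 2 * k + 1" "d dvd 3 * k + 1"
    then have "d dvd 3 * (2 * k + 1) - 2 * (3 * k + 1)"
      by (intro dvd_diff_nat dvd_mult)
    then show "is_unit d"
      by simp
  qed
  ultimately have "(2 * k + 1) dvd (3 * k choose k)"
    using coprime_dvd_mult_right_iff by blast
  then show ?thesis
    unfolding fuss_catalan_def by (rule dvd_mult_div_cancel)
qed

text \<open>Dividing the coefficient of \<open>X ^ n\<close> by \<open>n + 1\<close> leaves an integer because the
  factor \<open>1 / (2 * k + 1)\<close> is absorbed by a Fuss-Catalan number.\<close>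

lemma hyp_coeff_binomial:
  assumes "k \<le> n"
  shows "hyp_coeff k * of_nat (n + k + 1 choose (2 * k + 1)) =
    (of_nat ((n + 1) * ((n choose k) * (n + 1 + k choose k) * (6 * k choose (3 * k)) * fuss_catalan k))
      :: 'a :: field_char_0)"
proof -
  have "of_nat (2 * k + 1) * of_nat (fuss_catalan k) = (of_nat (3 * k choose k) :: 'a)"
    unfolding fuss_catalan[symmetric] by (rule of_nat_mult[symmetric])
  also have "\<dots> = fact (3 * k) / (fact k * fact (2 * k))"
    by (simp add: binomial_fact)
  finally have "of_nat (2 * k + 1) * of_nat (fuss_catalan k) = fact (3 * k) / (fact k * fact (2 * k) :: 'a)" .
  moreover have "fact (2 * k + 1) = of_nat (2 * k + 1) * (fact (2 * k) :: 'a)"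
    by simp
  moreover have "y = a / (b * (c * d))" if "c * y = a / (b * d)" "c \<noteq> 0" for a b c d y :: 'a
  proof -
    have "y = c * y / c"
      using that(2) by simp
    also have "\<dots> = a / (b * (c * d))"
      unfolding that(1) by (simp add: ac_simps)
    finally show ?thesis .
  qed
  moreover have "of_nat (2 * k + 1) \<noteq> (0 :: 'a)"
    by (simp only: of_nat_eq_0_iff)
  ultimately have fc: "(of_nat (fuss_catalan k) :: 'a) = fact (3 * k) / (fact k * fact (2 * k + 1))"
    by (simp only:)
  \<comment> \<open>The claim with factorials as variables: \<open>F6\<close>, \<open>F3\<close>,
    \<open>F\<close> for \<open>6k\<close>, \<open>3k\<close>, \<open>k\<close>; \<open>S\<close>,
    \<open>G\<close>, \<open>M\<close>, \<open>N\<close> for \<open>n + 1 + k\<close>,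
    \<open>2k + 1\<close>, \<open>n - k\<close>, \<open>n\<close>; and \<open>c\<close> for
    \<open>n + 1\<close> itself.\<close>
  have gen: "F6 / (F3 * F ^ 3) * (S / (G * M))
      = c * (N / (F * M) * (S / (F * (c * N))) * (F6 / (F3 * F3)) * (F3 / (F * G)))"
    if "F6 \<noteq> 0" "F3 \<noteq> 0" "F \<noteq> 0" "G \<noteq> 0" "M \<noteq> 0" "N \<noteq> 0" "c \<noteq> 0"
    for F6 F3 F S G M N c :: 'a
    using that by (simp add: field_simps power3_eq_cube)
  have c1: "(of_nat (n + k + 1 choose (2 * k + 1)) :: 'a) = fact (n + 1 + k) / (fact (2 * k + 1) * fact (n - k))"
    using assms by (subst binomial_fact) (simp_all add: ac_simps)
  have c2: "(of_nat (n choose k) :: 'a) = fact n / (fact k * fact (n - k))"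
    by (rule binomial_fact[OF assms])
  have c3: "(of_nat (n + 1 + k choose k) :: 'a) = fact (n + 1 + k) / (fact k * (of_nat (n + 1) * fact n))"
    by (subst binomial_fact) simp_all
  have c4: "(of_nat (6 * k choose (3 * k)) :: 'a) = fact (6 * k) / (fact (3 * k) * fact (3 * k))"
    by (subst binomial_fact) (simp_all flip: diff_mult_distrib)
  show ?thesis
    unfolding of_nat_mult fc hyp_coeff_def c1 c2 c3 c4
    by (rule gen) (simp_all only: fact_nonzero of_nat_eq_0_iff, simp_all)
qed

text \<open>The coefficient of \<open>x ^ (n + 1)\<close>, not \<open>x ^ n\<close>, in the
  antiderivative: the factor \<open>n + 1\<close> from \<open>hyp_coeff_binomial\<close> has already
  been divided out. Integrality is built into the type.\<close>

definition magnetic_coeff :: "nat \<Rightarrow> int" where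
  "magnetic_coeff n = (\<Sum>k=0..n. (- 432) ^ (n - k) *
     int ((n choose k) * (n + 1 + k choose k) * (6 * k choose (3 * k)) * fuss_catalan k))"

definition magnetic_fps :: "'a :: field_char_0 fps" where
  "magnetic_fps = Abs_fps (\<lambda>n. if n = 0 then 0 else of_int (magnetic_coeff (n - 1)))"

definition lin_fps :: "'a :: field_char_0 fps" where
  "lin_fps = 1 + fps_const 432 * fps_X"

text \<open>Solving \<open>t = T(x)\<close> for \<open>x\<close> makes \<open>1 - 1728 t\<close> the square of
  \<open>(1 - 432 x) / (1 + 432 x)\<close>.\<close>

definition T_fps :: "'a :: field_char_0 fps" where
  "T_fps = fps_X * inverse lin_fps ^ 2"

lemma fps_nth_lin_fps [simp]: "fps_nth lin_fps 0 = 1"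
  by (simp add: lin_fps_def)

text \<open>Here \<open>T_fps ^ k / lin_fps\<^sup>2 = X ^ k / (1 + 432 X) ^ (2k + 2)\<close>, so the
  negative binomial series gives each coefficient, and \<open>hyp_coeff_binomial\<close> extracts
  the factor \<open>n + 1\<close> produced by differentiation.\<close>

lemma fps_deriv_magnetic_fps:
  "fps_deriv magnetic_fps = (hyp_fps oo T_fps) * inverse lin_fps ^ 2" (is "_ = (?r :: 'a :: field_char_0 fps)")
proof (rule fps_ext)
  fix n
  let ?V = "inverse lin_fps ^ 2 :: 'a fps"
  have T0: "fps_nth T_fps 0 = (0 :: 'a)"
    by (simp add: T_fps_def)
  have pow: "fps_nth (T_fps ^ k * ?V) n =
      (if k \<le> n then of_nat (n + k + 1 choose (2 * k + 1)) * (- 432) ^ (n - k) else (0 :: 'a))" for k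
  proof -
    have "T_fps ^ k * ?V = fps_X ^ k * inverse lin_fps ^ Suc (2 * k + 1)"
      by (simp add: T_fps_def power_mult_distrib power_mult power_add power2_eq_square mult.assoc)
    then show ?thesis
      by (auto simp add: fps_X_power_mult_nth lin_fps_def inverse_linear_power_nth simp del: power_Suc)
         (simp add: algebra_simps)
  qed
  \<comment> \<open>\<open>T_fps ^ k\<close> has no terms below degree \<open>k\<close>, so the
    inner sum may run to the common bound \<open>n\<close>, which permits exchanging the
    sums.\<close>
  have trunc: "(\<Sum>k=0..j. hyp_coeff k * fps_nth (T_fps ^ k) j)
      = (\<Sum>k=0..n. hyp_coeff k * fps_nth (T_fps ^ k) j :: 'a)" if "j \<le> n" for j
    by (rule sum.mono_neutral_left) (use that in \<open>auto simp: startsby_zero_power_prefix[OF T0, rule_format]\<close>)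
  have "fps_nth ((hyp_fps oo T_fps) * ?V) n =
      (\<Sum>j=0..n. (\<Sum>k=0..j. hyp_coeff k * fps_nth (T_fps ^ k) j) * fps_nth ?V (n - j))"
    by (simp add: fps_mult_nth fps_compose_nth hyp_fps_def)
  also have "\<dots> = (\<Sum>j=0..n. (\<Sum>k=0..n. hyp_coeff k * fps_nth (T_fps ^ k) j) * fps_nth ?V (n - j))"
    by (intro sum.cong refl) (simp add: trunc)
  also have "\<dots> = (\<Sum>j=0..n. \<Sum>k=0..n. hyp_coeff k * (fps_nth (T_fps ^ k) j * fps_nth ?V (n - j)))"
    by (simp add: sum_distrib_right mult.assoc)
  also have "\<dots> = (\<Sum>k=0..n. hyp_coeff k * fps_nth (T_fps ^ k * ?V) n)"
    unfolding fps_mult_nth sum_distrib_left by (rule sum.swap)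
  also have "\<dots> = (\<Sum>k=0..n. (- 432) ^ (n - k) * (hyp_coeff k * of_nat (n + k + 1 choose (2 * k + 1))))"
    unfolding pow by (intro sum.cong) auto
  also have "\<dots> = (\<Sum>k=0..n. (- 432) ^ (n - k) *
      of_nat ((n + 1) * ((n choose k) * (n + 1 + k choose k) * (6 * k choose (3 * k)) * fuss_catalan k)))"
    by (intro sum.cong refl) (simp only: hyp_coeff_binomial atLeastAtMost_iff)
  also have "\<dots> = of_nat (n + 1) * of_int (magnetic_coeff n)"
    by (simp add: magnetic_coeff_def sum_distrib_left algebra_simps)
  also have "\<dots> = fps_nth (fps_deriv magnetic_fps) n"
    by (simp add: magnetic_fps_def)
  finally show "fps_nth (fps_deriv magnetic_fps) n = fps_nth ((hyp_fps oo T_fps) * ?V) n" ..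
qed

lemma fps_integral_coeffs_magnetic_fps: "fps_integral_coeffs magnetic_fps"
  by (simp add: fps_integral_coeffs_def magnetic_fps_def)

section \<open>The rationalising parameter and the antiderivative in \<open>q\<close>\<close>

definition x_fps :: "'a :: field_char_0 fps" where
  "x_fps = fps_inv T_fps oo t_fps"

lemma fps_nth_0_x_fps [simp]: "fps_nth x_fps 0 = 0"
  by (simp add: x_fps_def fps_inv_def)

lemma lin_fps_inverse: "lin_fps * inverse lin_fps = (1 :: 'a :: field_char_0 fps)"
  by (rule inverse_mult_eq_1') simp

lemma T_fps_compose_x_fps: "T_fps oo x_fps = (t_fps :: 'a :: field_char_0 fps)"
proof -
  have T: "fps_nth T_fps 0 = (0 :: 'a)" "fps_nth T_fps 1 \<noteq> (0 :: 'a)"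
    by (simp_all add: T_fps_def fps_power_zeroth)
  have "T_fps oo x_fps = (T_fps oo fps_inv T_fps) oo (t_fps :: 'a fps)"
    unfolding x_fps_def by (rule fps_compose_assoc) (simp_all add: fps_inv_def)
  then show ?thesis
    by (simp add: fps_inv_right[OF T])
qed

lemma lin_fps_compose_x_fps: "lin_fps oo x_fps = 1 + 432 * (x_fps :: 'a :: field_char_0 fps)"
  by (simp add: lin_fps_def fps_compose_add_distrib fps_compose_mult_distrib numeral_fps_const)

lemma x_fps_eq: "x_fps = t_fps * (1 + 432 * (x_fps :: 'a :: field_char_0 fps))\<^sup>2"
proof -
  have "T_fps * lin_fps\<^sup>2 = (fps_X :: 'a fps)"
    unfolding T_fps_def using lin_fps_inverse[where ?'a = 'a] by algebra
  then have "(T_fps * lin_fps\<^sup>2) oo x_fps = (x_fps :: 'a fps)"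
    by simp
  then show ?thesis
    by (simp add: fps_compose_mult_distrib fps_compose_power[symmetric] T_fps_compose_x_fps
        lin_fps_compose_x_fps)
qed

text \<open>In \<open>x = t * (1 + 432 * x)\<^sup>2\<close> the series \<open>t\<close> has no
  constant term, so the \<open>n\<close>-th coefficient of \<open>x\<close> is an integral
  polynomial expression in coefficients of \<open>t\<close> and earlier ones of
  \<open>x\<close>.\<close>

lemma fps_integral_coeffs_x_fps: "fps_integral_coeffs (x_fps :: 'a :: field_char_0 fps)"
  unfolding fps_integral_coeffs_def
proof
  fix n
  show "fps_nth x_fps n \<in> (\<int> :: 'a set)"
  proof (induction n rule: less_induct)
    case (less n)
    let ?y = "1 + 432 * (x_fps :: 'a fps)"
    have y: "fps_nth ?y i \<in> \<int>" if "i < n" for i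
      using less.IH[OF that] by (cases "i = 0") (auto simp: fps_nth_numeral_mult)
    have y2: "fps_nth (?y\<^sup>2) i \<in> \<int>" if "i < n" for i
      using that by (auto simp: power2_eq_square fps_mult_nth simp del: fps_add_nth intro!: Ints_sum Ints_mult y)
    have "fps_nth (t_fps * ?y\<^sup>2) n = (\<Sum>i=0..n. fps_nth t_fps i * fps_nth (?y\<^sup>2) (n - i))"
      by (rule fps_mult_nth)
    also have "\<dots> = (\<Sum>i\<in>{1..n}. fps_nth t_fps i * fps_nth (?y\<^sup>2) (n - i))"
      by (rule sum.mono_neutral_right) (auto simp: not_le)
    also have "\<dots> \<in> \<int>"
      using fps_integral_coeffs_t_fps y2
      by (intro Ints_sum Ints_mult) (auto simp: fps_integral_coeffs_def)
    finally show ?case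
      by (subst x_fps_eq)
  qed
qed

text \<open>The chain rule gives \<open>fps_XD g = H * V * fps_XD x\<close> with \<open>H\<close>
  the square root of \<open>Q_fps\<close>. The relations \<open>Q * D t = t * R\<close>,
  \<open>m * D x = p ^ 3 * D t\<close> and \<open>R * p = H ^ 3 * m\<close> then combine to the
  claim after cancelling \<open>m\<close>.\<close>

lemma Delta_fps_magnetic:
  obtains g :: "'a :: field_char_0 fps"
  where "fps_integral_coeffs g" "fps_XD g * Q_fps\<^sup>2 = Delta_fps"
proof
  define g where "g = (magnetic_fps oo x_fps :: 'a fps)"
  show "fps_integral_coeffs g"
    unfolding g_def
    by (intro fps_integral_coeffs_compose fps_integral_coeffs_magnetic_fps fps_integral_coeffs_x_fps)
  \<comment> \<open>The root function \<open>\<lambda>_ _. 1\<close> selects 1 as the square root of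
    the constant coefficient 1.\<close>
  define H :: "'a fps" where "H = fps_radical (\<lambda>_ _. 1) (Suc (Suc 0)) Q_fps"
  have H2: "H\<^sup>2 = Q_fps" and H0: "fps_nth H 0 = 1"
    using power_radical[of "Q_fps :: 'a fps" "\<lambda>_ _. 1" "Suc 0"]
    by (simp_all add: H_def numeral_2_eq_2)
  have H: "H = hyp_fps oo t_fps"
    by (rule sqrt_Q_fps_eq_hyp_fps_compose[OF H2 H0])
  define x t p m where "x = (x_fps :: 'a fps)" and "t = (t_fps :: 'a fps)"
    and "p = 1 + 432 * x" and "m = 1 - 432 * x"
  define V where "V = (inverse lin_fps ^ 2 oo x_fps :: 'a fps)"
  have xt: "x = t * p\<^sup>2"
    unfolding x_def t_def p_def by (rule x_fps_eq)
  have Vp: "V * p\<^sup>2 = 1"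
  proof -
    have "inverse lin_fps ^ 2 * lin_fps\<^sup>2 = (1 :: 'a fps)"
      using lin_fps_inverse[where ?'a = 'a] by algebra
    then have "(inverse lin_fps ^ 2 * lin_fps\<^sup>2) oo x_fps = (1 :: 'a fps)"
      by simp
    then show ?thesis
      by (simp add: fps_compose_mult_distrib fps_compose_power[symmetric] V_def p_def x_def
          lin_fps_compose_x_fps)
  qed
  have "fps_XD g = ((hyp_fps oo T_fps) * inverse lin_fps ^ 2 oo x_fps) * fps_XD x_fps"
    unfolding g_def by (simp add: fps_XD_compose fps_deriv_magnetic_fps)
  also have "(hyp_fps oo T_fps) * inverse lin_fps ^ 2 oo x_fps = (hyp_fps oo T_fps oo x_fps) * V"
    unfolding V_def by (rule fps_compose_mult_distrib) simp
  also have "hyp_fps oo T_fps oo x_fps = hyp_fps oo (T_fps oo x_fps)"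
    by (rule fps_compose_assoc[symmetric]) (simp_all add: T_fps_def)
  also have "\<dots> = H"
    by (simp add: T_fps_compose_x_fps H)
  finally have Dg: "fps_XD g = H * V * fps_XD x"
    by (simp add: x_def)
  have Dp: "fps_XD p = 432 * fps_XD x"
    by (simp add: p_def fps_XD_mult fps_XD_numeral fps_XD_1)
  \<comment> \<open>Multiplying by \<open>p\<close> turns \<open>864 * t * p\<close> into
    \<open>864 * t * p\<^sup>2 = 864 * x\<close>, and \<open>p - 864 * x = m\<close>.\<close>
  have "fps_XD x = fps_XD t * p\<^sup>2 + 864 * t * p * fps_XD x"
    using arg_cong[OF xt, of fps_XD] by (simp add: fps_XD_mult power2_eq_square Dp algebra_simps)
  then have "p * fps_XD x = fps_XD t * p ^ 3 + 864 * (t * p\<^sup>2) * fps_XD x"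
    by algebra
  then have "p * fps_XD x = fps_XD t * p ^ 3 + 864 * x * fps_XD x"
    by (simp flip: xt)
  then have Dx: "m * fps_XD x = fps_XD t * p ^ 3"
    unfolding p_def m_def by (simp add: algebra_simps)
  have "R_fps\<^sup>2 = Q_fps ^ 3 - 1728 * (t * Q_fps ^ 3)"
    unfolding t_def t_fps_mult_Q_fps Delta_fps by simp
  then have "(R_fps * p)\<^sup>2 = H ^ 6 * (p\<^sup>2 - 1728 * (t * p\<^sup>2))"
    unfolding H2[symmetric] by algebra
  \<comment> \<open>The origin of 432:
    \<open>p\<^sup>2 - m\<^sup>2 = 4 * 432 * x = 1728 * x\<close>.\<close>
  also have "p\<^sup>2 - 1728 * (t * p\<^sup>2) = m\<^sup>2"
    unfolding xt[symmetric] unfolding p_def m_def by algebra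
  also have "H ^ 6 * m\<^sup>2 = (H ^ 3 * m)\<^sup>2"
    by algebra
  finally have "R_fps * p = H ^ 3 * m \<or> R_fps * p = - (H ^ 3 * m)"
    by (simp add: power2_eq_iff)
  \<comment> \<open>Constant coefficients decide the sign of the square root.\<close>
  moreover have "fps_nth (R_fps * p) 0 = 1" "fps_nth (H ^ 3 * m) 0 = 1" "fps_nth (- (H ^ 3 * m)) 0 = - 1"
    by (simp_all add: p_def m_def x_def H0 fps_power_zeroth fps_nth_numeral_mult)
  ultimately have Rp: "R_fps * p = H ^ 3 * m"
    by (metis one_neq_neg_one)
  have Dt: "Q_fps * fps_XD t = t * R_fps"
    unfolding t_def by (rule fps_XD_t_fps)
  have "m * (fps_XD g * Q_fps\<^sup>2) = H * V * Q_fps\<^sup>2 * (m * fps_XD x)"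
    unfolding Dg by (simp add: ac_simps)
  also have "\<dots> = H * Q_fps\<^sup>2 * (V * p\<^sup>2) * p * fps_XD t"
    unfolding Dx by (simp add: power2_eq_square power3_eq_cube ac_simps)
  also have "\<dots> = H * Q_fps * p * (Q_fps * fps_XD t)"
    unfolding Vp by (simp add: power2_eq_square ac_simps)
  also have "\<dots> = H * Q_fps * t * (R_fps * p)"
    unfolding Dt by (simp add: ac_simps)
  also have "\<dots> = (H\<^sup>2)\<^sup>2 * Q_fps * t * m"
    unfolding Rp by (simp add: power2_eq_square power3_eq_cube ac_simps)
  also have "\<dots> = m * (t * Q_fps ^ 3)"
    unfolding H2 by (simp add: power2_eq_square power3_eq_cube ac_simps)
  also have "\<dots> = m * Delta_fps"
    unfolding t_def t_fps_mult_Q_fps ..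
  finally have "m * (fps_XD g * Q_fps\<^sup>2) = m * Delta_fps" .
  moreover have "m \<noteq> 0"
  proof
    assume "m = 0"
    then have "fps_nth m 0 = 0"
      by simp
    then show False
      by (simp add: m_def x_def fps_nth_numeral_mult)
  qed
  ultimately show "fps_XD g * Q_fps\<^sup>2 = Delta_fps"
    by simp
qed

subsection \<open>Convergence\<close>

text \<open>As \<open>P_fps\<close> has constant term 1, a nonzero difference with leading index
  \<open>n\<close> satisfies \<open>n * c = c\<close> for its leading coefficient \<open>c\<close>;
  so \<open>n = 1\<close>, where the two series agree.\<close>

lemma fps_XD_eq_P_fps_mult_unique:
  fixes f g :: "'a :: field_char_0 fps"
  assumes "fps_XD f = P_fps * f" "fps_XD g = P_fps * g" "fps_nth f 0 = fps_nth g 0" "fps_nth f 1 = fps_nth g 1"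
  shows "f = g"
proof (rule ccontr)
  assume "f \<noteq> g"
  define d n where "d = f - g" and "n = subdegree d"
  have "d \<noteq> 0"
    using \<open>f \<noteq> g\<close> by (simp add: d_def)
  have n: "fps_nth d n \<noteq> 0" "\<And>i. i < n \<Longrightarrow> fps_nth d i = 0"
    using \<open>d \<noteq> 0\<close> by (auto simp: n_def)
  have "fps_XD d = P_fps * d"
    by (simp add: d_def fps_XD_diff assms right_diff_distrib)
  then have "of_nat n * fps_nth d n = fps_nth (P_fps * d) n"
    by (metis fps_XD_nth)
  also have "\<dots> = fps_nth d n"
    using n(2) by (subst fps_mult_nth_leading) auto
  finally have "n = 1"
    using n(1) by simp
  from n(1) have "fps_nth d 1 \<noteq> 0"
    by (simp only: \<open>n = 1\<close>) simp
  then show False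
    unfolding d_def using assms(4) by simp
qed

lemma fps_nth_1_Delta_fps: "fps_nth Delta_fps 1 = (1 :: 'a :: field_char_0)"
proof -
  have "{d :: nat. d dvd 1} = {1}"
    by auto
  then have "fps_nth Q_fps 1 = (240 :: 'a)" "fps_nth R_fps 1 = (- 504 :: 'a)"
    by (simp_all add: Q_fps_def R_fps_def fps_nth_numeral_mult divisor_fps_nth)
  then have "fps_nth (1728 * Delta_fps) 1 = (1728 :: 'a)"
    unfolding Delta_fps by (simp add: power2_eq_square power3_eq_cube fps_mult_nth_1)
  then show ?thesis
    by (simp add: fps_nth_numeral_mult)
qed

section \<open>Partial products of the Euler product\<close>

definition euler_partial_fps :: "nat \<Rightarrow> 'a :: comm_ring_1 fps" where
  "euler_partial_fps N = (\<Prod>k<N. 1 - fps_X ^ Suc k)"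

text \<open>The logarithmic derivative of \<open>1 - X ^ d\<close> is
  \<open>- d * X ^ d / (1 - X ^ d)\<close>; the series with 0-1 coefficients is the geometric series
  over positive multiples of \<open>d\<close>.\<close>

lemma fps_XD_euler_partial_fps:
  "fps_XD (euler_partial_fps N) = euler_partial_fps N *
     (\<Sum>k<N. - of_nat (Suc k) * Abs_fps (\<lambda>m. if m > 0 \<and> Suc k dvd m then 1 else 0) :: 'a :: comm_ring_1 fps)"
proof -
  define K :: "nat \<Rightarrow> 'a fps" where "K = (\<lambda>d. Abs_fps (\<lambda>m. if m > 0 \<and> d dvd m then 1 else 0))"
  have K: "(1 - fps_X ^ d) * K d = fps_X ^ d" if "d > 0" for d
  proof (rule fps_ext)
    fix m
    have "d dvd m - d \<longleftrightarrow> d dvd m" if "d \<le> m"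
      using that by (metis dvd_minus_self not_le)
    moreover have "d \<le> m" if "d dvd m" "m > 0"
      using that by (rule dvd_imp_le)
    ultimately show "fps_nth ((1 - fps_X ^ d) * K d) m = fps_nth (fps_X ^ d) m"
      using \<open>d > 0\<close> by (cases "m < d") (auto simp: left_diff_distrib K_def fps_X_power_mult_nth)
  qed
  have XD: "fps_XD (1 - fps_X ^ d) = (1 - fps_X ^ d) * (- of_nat d * K d)" if "d > 0" for d
  proof -
    have "fps_XD (1 - fps_X ^ d) = - of_nat d * (fps_X ^ d :: 'a fps)"
      by (rule fps_ext) (auto simp: fps_of_nat[symmetric] simp del: fps_of_nat)
    also have "\<dots> = - of_nat d * ((1 - fps_X ^ d) * K d)"
      by (simp only: K[OF that])
    also have "\<dots> = (1 - fps_X ^ d) * (- of_nat d * K d)"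
      by (rule mult.left_commute)
    finally show ?thesis .
  qed
  have "fps_XD (euler_partial_fps N) = euler_partial_fps N * (\<Sum>k<N. - of_nat (Suc k) * K (Suc k))"
  proof (induction N)
    case (Suc N)
    have "fps_XD (euler_partial_fps (Suc N)) = fps_XD (euler_partial_fps N * (1 - fps_X ^ Suc N) :: 'a fps)"
      by (simp add: euler_partial_fps_def)
    also have "\<dots> = euler_partial_fps N * (1 - fps_X ^ Suc N)
        * ((\<Sum>k<N. - of_nat (Suc k) * K (Suc k)) + - of_nat (Suc N) * K (Suc N))"
      unfolding fps_XD_mult Suc.IH XD[OF zero_less_Suc] by (simp only: ring_distribs ac_simps)
    finally show ?case
      by (simp add: euler_partial_fps_def)
  qed (simp add: euler_partial_fps_def fps_XD_1)
  then show ?thesis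
    by (simp add: K_def)
qed

text \<open>Once \<open>N\<close> reaches \<open>m\<close>, every divisor of \<open>m > 0\<close>
  occurs among the indices, so each coefficient of the logarithmic derivative stabilises.\<close>

lemma sum_divisors_eventually:
  assumes "m \<le> N"
  shows "fps_nth (\<Sum>k<N. - of_nat (Suc k) * Abs_fps (\<lambda>m. if m > 0 \<and> Suc k dvd m then 1 else 0)) m
    = - fps_nth (sigma_fps 1 :: 'a :: comm_ring_1 fps) m"
proof (cases "m = 0")
  case False
  have "fps_nth (\<Sum>k<N. - of_nat (Suc k) * Abs_fps (\<lambda>m. if m > 0 \<and> Suc k dvd m then 1 else 0)) m
      = (\<Sum>k<N. - (if Suc k dvd m then of_nat (Suc k) else 0 :: 'a))"
    unfolding fps_sum_nth using False
    by (intro sum.cong refl) (simp add: fps_of_nat[symmetric] del: fps_of_nat of_nat_Suc)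
  also have "\<dots> = - (\<Sum>k | k < N \<and> Suc k dvd m. of_nat (Suc k))"
    unfolding sum_negf by (subst sum.inter_filter[symmetric]) (auto simp: lessThan_def)
  also have "(\<Sum>k | k < N \<and> Suc k dvd m. of_nat (Suc k)) = (\<Sum>d | d dvd m. of_nat d :: 'a)"
  proof (rule sum.reindex_bij_witness[where i = "\<lambda>d. d - 1" and j = Suc])
    fix d assume "d \<in> {d. d dvd m}"
    then have "0 < d" "d \<le> m" "d dvd m"
      using False by (auto intro: dvd_imp_le dvd_pos_nat)
    then show "Suc (d - 1) = d" "d - 1 \<in> {k. k < N \<and> Suc k dvd m}"
      using assms by auto
  qed auto
  finally show ?thesis
    by (simp add: divisor_fps_nth)
qed (simp add: fps_sum_nth fps_of_nat[symmetric] del: fps_of_nat of_nat_Suc)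

section \<open>Convergence of the Euler product\<close>

definition euler_prod :: "complex \<Rightarrow> complex" where
  "euler_prod q = (\<Prod>k. 1 - q ^ Suc k)"

lemma convergent_prod_euler:
  assumes "norm q < 1"
  shows "convergent_prod (\<lambda>k. 1 - q ^ Suc k :: complex)"
proof -
  have "summable (\<lambda>k. norm ((1 - q ^ Suc k) - 1))"
    using summable_mult[OF summable_geometric[of "norm q"], of "norm q"] assms
    by (simp add: norm_power norm_mult)
  then have "abs_convergent_prod (\<lambda>k. 1 - q ^ Suc k)"
    by (rule summable_imp_abs_convergent_prod)
  then show ?thesis
    by (rule abs_convergent_prod_imp_convergent_prod)
qed

text \<open>On the disc of radius 1/2 the M-test applies with majorant
  \<open>(1 / 2) ^ Suc k\<close>. Uniformity is what lets Taylor coefficients pass to the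
  limit.\<close>

lemma uniform_limit_euler_prod:
  "uniform_limit (cball 0 (1 / 2)) (\<lambda>N q. \<Prod>k<N. 1 - q ^ Suc k) euler_prod sequentially"
proof -
  let ?A = "cball 0 (1 / 2) :: complex set"
  have "uniformly_convergent_on ?A (\<lambda>N q. \<Sum>k<N. norm ((1 - q ^ Suc k) - 1))"
  proof (rule Weierstrass_m_test')
    show "summable (\<lambda>k. (1 / 2) ^ Suc k :: real)"
      by (subst summable_Suc_iff) (rule summable_geometric, simp)
    show "norm (norm ((1 - q ^ Suc k) - 1)) \<le> (1 / 2) ^ Suc k" if "q \<in> ?A" for k q
      using that power_mono[of "norm q" "1 / 2" "Suc k"] by (simp add: norm_power norm_mult)
  qed
  then have "uniformly_convergent_on ?A (\<lambda>N q. \<Prod>k<N. 1 - q ^ Suc k)"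
    by (intro uniformly_convergent_on_prod' continuous_intros) auto
  then obtain U where U: "uniform_limit ?A (\<lambda>N q. \<Prod>k<N. 1 - q ^ Suc k) U sequentially"
    by (auto simp: uniformly_convergent_on_def)
  have "U q = euler_prod q" if "q \<in> ?A" for q
  proof (rule LIMSEQ_unique)
    show "(\<lambda>N. \<Prod>k<N. 1 - q ^ Suc k) \<longlonglongrightarrow> U q"
      using tendsto_uniform_limitI[OF U that] .
    have "(\<lambda>n. \<Prod>k\<le>n. 1 - q ^ Suc k) \<longlonglongrightarrow> euler_prod q"
      unfolding euler_prod_def using that by (intro convergent_prod_LIMSEQ convergent_prod_euler) auto
    then show "(\<lambda>N. \<Prod>k<N. 1 - q ^ Suc k) \<longlonglongrightarrow> euler_prod q"
      by (simp only: LIMSEQ_lessThan_iff_atMost)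
  qed
  then show ?thesis
    using U by (subst uniform_limit_cong'[where g = "\<lambda>N q. \<Prod>k<N. 1 - q ^ Suc k" and i = U]) auto
qed

text \<open>A uniform limit of holomorphic functions is holomorphic and its Taylor coefficients are
  limits of theirs. Each coefficient of the logarithmic derivative identity is a finite sum, so the
  identity survives the limit.\<close>

lemma euler_prod_has_fps_expansion:
  obtains G where "euler_prod has_fps_expansion G"
    "fps_XD G = G * - sigma_fps 1" "fps_nth G 0 = 1"
proof
  let ?A = "ball 0 (1 / 2) :: complex set"
  let ?p = "\<lambda>N q. \<Prod>k<N. 1 - q ^ Suc k :: complex"
  define G where "G = fps_expansion euler_prod 0"
  have lim: "uniform_limit ?A ?p euler_prod sequentially"
    by (rule uniform_limit_on_subset[OF uniform_limit_euler_prod]) auto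
  have holo: "?p N holomorphic_on B" for N B
    by (intro holomorphic_intros)
  have "euler_prod holomorphic_on ?A"
  proof (rule holomorphic_uniform_sequence[OF open_ball holo])
    fix x assume "x \<in> ?A"
    then obtain d where "0 < d" "cball x d \<subseteq> ?A"
      using open_contains_cball[THEN iffD1, OF open_ball] by blast
    then show "\<exists>d. 0 < d \<and> cball x d \<subseteq> ?A \<and> uniform_limit (cball x d) ?p euler_prod sequentially"
      using uniform_limit_on_subset[OF lim] by blast
  qed
  then have "euler_prod analytic_on {0}"
    unfolding analytic_at by (intro exI[of _ ?A]) simp
  then show exp: "euler_prod has_fps_expansion G"
    unfolding G_def by (rule analytic_at_imp_has_fps_expansion_0)
  have pexp: "?p N has_fps_expansion euler_partial_fps N" for N
    unfolding euler_partial_fps_def by (intro fps_expansion_intros)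
  have coeff: "(\<lambda>N. fps_nth (euler_partial_fps N) m) \<longlonglongrightarrow> fps_nth G m" for m
  proof -
    have "(\<lambda>N. (deriv ^^ m) (?p N) 0 / fact m) \<longlonglongrightarrow> (deriv ^^ m) euler_prod 0 / fact m"
      by (intro tendsto_divide tendsto_const
            higher_deriv_complex_uniform_limit[OF lim always_eventually[OF allI[OF holo]]]) auto
    then show ?thesis
      by (simp add: fps_nth_fps_expansion[OF pexp] fps_nth_fps_expansion[OF exp])
  qed
  show "fps_nth G 0 = 1"
  proof (rule LIMSEQ_unique[OF coeff])
    have "fps_nth (euler_partial_fps N) 0 = (1 :: complex)" for N
      by (induction N) (simp_all add: euler_partial_fps_def)
    then show "(\<lambda>N. fps_nth (euler_partial_fps N) 0) \<longlonglongrightarrow> (1 :: complex)"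
      by simp
  qed
  show "fps_XD G = G * - sigma_fps 1"
  proof (rule fps_ext)
    fix m
    let ?L = "\<lambda>N. \<Sum>k<N. - of_nat (Suc k) * Abs_fps (\<lambda>m. if m > 0 \<and> Suc k dvd m then 1 else 0) :: complex fps"
    have "(\<lambda>N. \<Sum>i=0..m. fps_nth (euler_partial_fps N) i * fps_nth (?L N) (m - i))
        \<longlonglongrightarrow> (\<Sum>i=0..m. fps_nth G i * - fps_nth (sigma_fps 1) (m - i))"
    proof (intro tendsto_sum tendsto_mult coeff)
      fix i
      show "(\<lambda>N. fps_nth (?L N) (m - i)) \<longlonglongrightarrow> - fps_nth (sigma_fps 1) (m - i)"
        by (rule tendsto_eventually, rule eventually_mono[OF eventually_ge_at_top[of "m - i"]])
           (rule sum_divisors_eventually)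
    qed
    also have "(\<lambda>N. \<Sum>i=0..m. fps_nth (euler_partial_fps N) i * fps_nth (?L N) (m - i))
        = (\<lambda>N. of_nat m * fps_nth (euler_partial_fps N) m)"
      unfolding fps_mult_nth[symmetric] fps_XD_euler_partial_fps[symmetric] by simp
    finally have "(\<lambda>N. of_nat m * fps_nth (euler_partial_fps N) m)
        \<longlonglongrightarrow> (\<Sum>i=0..m. fps_nth G i * - fps_nth (sigma_fps 1) (m - i))" .
    moreover have "(\<lambda>N. of_nat m * fps_nth (euler_partial_fps N) m) \<longlonglongrightarrow> of_nat m * fps_nth G m"
      by (intro tendsto_mult tendsto_const coeff)
    ultimately have "of_nat m * fps_nth G m = (\<Sum>i=0..m. fps_nth G i * - fps_nth (sigma_fps 1) (m - i))"
      using LIMSEQ_unique by blast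
    then show "fps_nth (fps_XD G) m = fps_nth (G * - sigma_fps 1) m"
      by (simp add: fps_mult_nth sum_negf)
  qed
qed

text \<open>The series \<open>X * G ^ 24\<close> has logarithmic derivative
  \<open>1 - 24 * sigma_fps 1 = P_fps\<close> and begins with \<open>X\<close>, so it is
  \<open>Delta_fps\<close> by uniqueness.\<close>

lemma Delta_fps_expansion:
  "(\<lambda>q. q * (\<Prod>n. (1 - q ^ Suc n) ^ 24)) has_fps_expansion (Delta_fps :: complex fps)"
proof -
  obtain G where G: "euler_prod has_fps_expansion G" "fps_XD G = G * - sigma_fps 1" "fps_nth G 0 = 1"
    by (rule euler_prod_has_fps_expansion)
  have "(\<lambda>q. q * euler_prod q ^ 24) has_fps_expansion fps_X * G ^ 24"
    by (intro fps_expansion_intros G(1))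
  also have "fps_X * G ^ 24 = Delta_fps"
  proof (rule fps_XD_eq_P_fps_mult_unique)
    have pow: "fps_XD (G ^ n) = of_nat n * G ^ n * - sigma_fps 1" for n
      by (induction n) (simp_all add: fps_XD_1 fps_XD_mult G(2) algebra_simps)
    have "fps_XD (fps_X * G ^ 24) = fps_X * (24 * G ^ 24 * - sigma_fps 1) + fps_X * G ^ 24"
      unfolding fps_XD_mult pow by (simp add: fps_XD_def)
    then show "fps_XD (fps_X * G ^ 24) = P_fps * (fps_X * G ^ 24)"
      unfolding P_fps_def by (simp add: algebra_simps)
  qed (simp_all add: fps_XD_Delta_fps fps_nth_1_Delta_fps[unfolded One_nat_def] G(3) fps_power_zeroth)
  finally have exp: "(\<lambda>q. q * euler_prod q ^ 24) has_fps_expansion Delta_fps" .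
  have "eventually (\<lambda>q. q \<in> ball 0 1) (nhds (0 :: complex))"
    by (rule eventually_nhds_in_open) auto
  then have ev: "eventually (\<lambda>q. q * euler_prod q ^ 24 = q * (\<Prod>n. (1 - q ^ Suc n) ^ 24)) (nhds 0)"
    by eventually_elim (simp add: euler_prod_def prodinf_power convergent_prod_euler del: power_Suc)
  show ?thesis
    by (rule has_fps_expansion_cong[OF ev refl, THEN iffD1, OF exp])
qed

lemma E4_expansion:
  "(\<lambda>q. 1 + 240 * (\<Sum>n. (\<Sum>r | r dvd Suc n. of_nat r ^ 3) * q ^ Suc n)) has_fps_expansion
     (Q_fps :: complex fps)"
proof (rule has_fps_expansionI)
  \<comment> \<open>The radius fits the crude bound on the sum of cubes of divisors by
    \<open>n ^ 4 \<le> (2 ^ n) ^ 4 = 16 ^ n\<close>: the terms are then at most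
    \<open>(1 / 2) ^ n\<close>.\<close>
  have "eventually (\<lambda>q. q \<in> ball 0 (1 / 32)) (nhds (0 :: complex))"
    by (rule eventually_nhds_in_open) auto
  then show "eventually (\<lambda>q. (\<lambda>n. fps_nth Q_fps n * q ^ n) sums
      (1 + 240 * (\<Sum>n. (\<Sum>r | r dvd Suc n. of_nat r ^ 3) * q ^ Suc n))) (nhds (0 :: complex))"
  proof eventually_elim
    case (elim q)
    define s where "s = (\<lambda>n. fps_nth (sigma_fps 3) n :: complex)"
    have bound: "norm (s n) \<le> 16 ^ n" if "n > 0" for n
    proof -
      have "norm (s n) \<le> (\<Sum>r | r dvd n. norm (of_nat r ^ 3 :: complex))"
        unfolding s_def divisor_fps_nth by (rule norm_sum)
      also have "\<dots> \<le> (\<Sum>r\<in>{1..n}. real n ^ 3)"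
      proof (rule sum_mono2[THEN order_trans])
        show "{r. r dvd n} \<subseteq> {1..n}"
          using that by (auto intro: dvd_imp_le dvd_pos_nat simp: Suc_le_eq)
        show "(\<Sum>r\<in>{1..n}. norm (of_nat r ^ 3 :: complex)) \<le> (\<Sum>r\<in>{1..n}. real n ^ 3)"
          by (intro sum_mono) (simp add: norm_power power_mono)
      qed auto
      also have "\<dots> = real n ^ 4"
        by (simp add: power_numeral_reduce)
      also have "\<dots> \<le> (2 ^ n) ^ 4"
        by (intro power_mono) (simp_all add: less_imp_le)
      also have "\<dots> = (2 ^ 4) ^ n"
        by (simp only: power_mult[symmetric] mult.commute)
      also have "\<dots> = 16 ^ n"
        by simp
      finally show ?thesis .
    qed
    have "summable (\<lambda>n. s n * q ^ n)"
    proof (rule summable_comparison_test)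
      show "summable (\<lambda>n. (1 / 2) ^ n :: real)"
        by (rule summable_geometric) simp
      have "norm (s n * q ^ n) \<le> (1 / 2) ^ n" if "n > 0" for n
      proof -
        have "norm (s n * q ^ n) \<le> 16 ^ n * (1 / 32) ^ n"
          unfolding norm_mult norm_power
          using elim by (intro mult_mono bound that power_mono) auto
        also have "\<dots> = (1 / 2) ^ n"
          by (simp flip: power_mult_distrib)
        finally show ?thesis .
      qed
      then show "\<exists>N. \<forall>n\<ge>N. norm (s n * q ^ n) \<le> (1 / 2) ^ n"
        by (intro exI[of _ 1]) auto
    qed
    then have "(\<lambda>n. s n * q ^ n) sums (\<Sum>n. s n * q ^ n)"
      by (rule summable_sums)
    moreover have "(\<Sum>n. s n * q ^ n) = (\<Sum>n. s (Suc n) * q ^ Suc n)"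
      using suminf_split_head[OF \<open>summable (\<lambda>n. s n * q ^ n)\<close>] by (simp add: s_def)
    ultimately have "(\<lambda>n. 240 * (s n * q ^ n)) sums (240 * (\<Sum>n. s (Suc n) * q ^ Suc n))"
      by (intro sums_mult) simp
    moreover have "(\<lambda>n. if n = 0 then 1 else 0) sums (1 :: complex)"
      by (rule sums_single)
    ultimately have "(\<lambda>n. (if n = 0 then 1 else 0) + 240 * (s n * q ^ n)) sums
        (1 + 240 * (\<Sum>n. s (Suc n) * q ^ Suc n))"
      by (rule sums_add[rotated])
    moreover have "(\<lambda>n. (if n = 0 then 1 else 0) + 240 * (s n * q ^ n)) = (\<lambda>n. fps_nth Q_fps n * q ^ n)"
      by (auto simp: fun_eq_iff Q_fps_def s_def fps_nth_numeral_mult distrib_right)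
    ultimately show ?case
      by (simp only: s_def divisor_fps_nth)
  qed
qed

text \<open>Since \<open>norm (nome z) = exp (- 2 * pi * Im z)\<close>, the half-plane covers a
  punctured disc. This turns a Fourier expansion near the cusp into a power series in
  \<open>q\<close>.\<close>

lemma nome_surj:
  assumes "q \<noteq> 0" "norm q < exp (- 2 * pi * Y)"
  obtains z where "nome z = q" "Im z > Y"
proof
  let ?z = "Ln q / (2 * of_real pi * \<i>)"
  show "nome ?z = q"
    using assms(1) by (simp add: nome_def)
  have "ln (norm q) < - 2 * pi * Y"
    using assms by (metis ln_exp ln_less_cancel_iff exp_gt_zero zero_less_norm_iff)
  then have "Y < - ln (norm q) / (2 * pi)"
    by (simp add: field_simps)
  also have "- ln (norm q) / (2 * pi) = Im ?z"
  proof -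
    have "?z = - \<i> * Ln q / of_real (2 * pi)"
      by (simp add: field_simps)
    then show ?thesis
      using assms(1) by (simp only: Im_divide_of_real) simp
  qed
  finally show "Im ?z > Y" .
qed

theorem theorem1p5:
  fixes a :: "nat \<Rightarrow> complex"
  assumes "has_cuspidal_Fourier_expansion
             (\<lambda>z. 64 * (Ramanujan_Delta z / (Eisenstein_E4 z)\<^sup>2)) a"
  shows "\<forall>n\<ge>1. \<exists>k::int. a n = of_int k \<and> int n dvd k"
proof -
  define D where "D = (\<lambda>q :: complex. q * (\<Prod>n. (1 - q ^ Suc n) ^ 24))"
  define E where "E = (\<lambda>q :: complex. 1 + 240 * (\<Sum>n. (\<Sum>r | r dvd Suc n. of_nat r ^ 3) * q ^ Suc n))"
  define F where "F = (\<lambda>q. 64 * (D q / (E q)\<^sup>2))"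
  \<comment> \<open>The constant coefficient is set to 0 because the Fourier expansion starts at
    \<open>n = 1\<close>.\<close>
  define A where "A = Abs_fps (\<lambda>n. if n = 0 then 0 else a n)"
  have D: "D has_fps_expansion Delta_fps" and E: "E has_fps_expansion Q_fps"
    unfolding D_def E_def by (rule Delta_fps_expansion E4_expansion)+
  obtain Y where Y: "\<And>z. Im z > Y \<Longrightarrow>
      (\<lambda>n. a (Suc n) * nome z ^ Suc n) sums (64 * (Ramanujan_Delta z / (Eisenstein_E4 z)\<^sup>2))"
    using assms unfolding has_cuspidal_Fourier_expansion_def by blast
  have F: "F has_fps_expansion A"
  proof (rule has_fps_expansionI)
    have "eventually (\<lambda>q. q \<in> ball 0 (exp (- 2 * pi * Y))) (nhds (0 :: complex))"
      by (rule eventually_nhds_in_open) auto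
    then show "eventually (\<lambda>q. (\<lambda>n. fps_nth A n * q ^ n) sums F q) (nhds 0)"
    proof eventually_elim
      case (elim q)
      \<comment> \<open>The point \<open>q = 0\<close> is not a value of \<open>nome\<close>; there
        both sides are 0.\<close>
      have "(\<lambda>n. a (Suc n) * q ^ Suc n) sums F q"
      proof (cases "q = 0")
        case False
        with elim obtain z where "nome z = q" "Im z > Y"
          using nome_surj[of q Y] by auto
        then show ?thesis
          using Y[of z] by (simp add: F_def D_def E_def Ramanujan_Delta_def Eisenstein_E4_def)
      qed (simp add: F_def D_def)
      then show ?case
        using sums_Suc_iff[of "\<lambda>n. fps_nth A n * q ^ n" "F q"] by (simp add: A_def)
    qed
  qed
  have FE: "(\<lambda>q. F q * (E q)\<^sup>2) has_fps_expansion A * Q_fps\<^sup>2"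
    by (intro fps_expansion_intros F E)
  have D64: "(\<lambda>q. 64 * D q) has_fps_expansion 64 * Delta_fps"
    by (intro fps_expansion_intros D)
  \<comment> \<open>\<open>E\<close> is continuous with \<open>E 0 = 1\<close>, so near 0 the
    quotient can be multiplied out.\<close>
  have ev: "eventually (\<lambda>q. F q * (E q)\<^sup>2 = 64 * D q) (nhds 0)"
  proof -
    have "isCont E 0"
      using has_fps_expansion_imp_continuous[OF E, of UNIV] by simp
    moreover have "E 0 = 1"
      by (simp add: E_def)
    ultimately have "eventually (\<lambda>q. E q \<noteq> 0) (nhds 0)"
      by (intro tendsto_imp_eventually_ne[of E 1]) (auto simp: continuous_at tendsto_nhds_iff)
    then show ?thesis
      by eventually_elim (simp add: F_def)
  qed
  have "A * Q_fps\<^sup>2 = 64 * Delta_fps"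
    by (rule fps_expansion_unique_complex[OF has_fps_expansion_cong[OF ev refl, THEN iffD1, OF FE] D64])
  moreover obtain g :: "complex fps" where g: "fps_integral_coeffs g" "fps_XD g * Q_fps\<^sup>2 = Delta_fps"
    by (rule Delta_fps_magnetic)
  ultimately have "A * Q_fps\<^sup>2 = (64 * fps_XD g) * Q_fps\<^sup>2"
    by (simp add: mult.assoc)
  then have A: "A = 64 * fps_XD g"
    by (simp add: Q_fps_nonzero)
  show ?thesis
  proof (intro allI impI)
    fix n :: nat
    assume "n \<ge> 1"
    obtain k where k: "fps_nth g n = of_int k"
      using g(1) by (auto simp: fps_integral_coeffs_def elim!: Ints_cases)
    have "a n = fps_nth A n"
      using \<open>n \<ge> 1\<close> by (simp add: A_def)
    also have "\<dots> = of_int (int n * (64 * k))"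
      by (simp add: A fps_nth_numeral_mult k)
    finally show "\<exists>k::int. a n = of_int k \<and> int n dvd k"
      by (intro exI[of _ "int n * (64 * k)"]) simp
  qed
qed

end
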